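(* In the noiseless model, for any $\varepsilon\in(0,1/18)$ there is a randomized algorithm for PARTITION on $n$ elements with query complexity $O(n)$ and round complexity $4$ which, for all $c$, outputs a partition with zero $c$-weighted error with probability at least $1-e^{-\Omega(n^{\varepsilon})}$.
   Context: Setting. The input is a set of $n$ elements with an unknown total order, presented in uniformly random order (the elements are a priori indistinguishable). For $i\in\{1,\dots,n\}$ the $i$-th smallest element is denoted $i$. PARTITION (with cutoff the median, $k=n/2$): output a partition of the elements into a set $A$ (accepted, meant to be the elements above the median) and a set $R$ (rejected, meant to be the elements below the median). For a constant $c\ge 0$, the $c$-weighted error of $A\sqcup R$ is $\sum_{i>n/2} I(i\in R)\,|i-n/2|^c+\sum_{i<n/2} I(i\in A)\,|i-n/2|^c$, where $I$ is the indicator function (so zero error means no element above or below the median is misplaced). Algorithms access the order only through pairwise comparison queries. Query complexity is the total number of comparisons; round complexity is the number of adaptive rounds (within a round all queries are chosen before any answer of that round is seen). Noiseless model: every comparison returns the correct answer. Asymptotics are as $n\to\infty$. Probabilities are over the random input order and the algorithm's randomness. *)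

theory Defs
  imports "HOL-Probability.Probability" "HOL-Combinatorics.Permutations"
begin

text \<open>
  The \<open>n\<close> elements carry the labels \<open>{1..n}\<close>, which are all that an algorithm sees of them.
  The hidden total order is a permutation \<open>\<pi>\<close> of \<open>{1..n}\<close>: the element labelled \<open>x\<close> is the
  \<open>\<pi> x\<close>-th smallest one.

  A deterministic algorithm is a decision tree. \<open>Round qs k\<close> asks all the comparisons in the list
  \<open>qs\<close> at once and continues with \<open>k bs\<close>, where \<open>bs\<close> is the list of the answers.
  \<open>Output A R\<close> stops, accepting \<open>A\<close> and rejecting \<open>R\<close>.
\<close>

datatype algorithm =
    Output "nat set" "nat set"
  | Round "(nat \<times> nat) list" "bool list \<Rightarrow> algorithm"

definition answers :: "(nat \<Rightarrow> nat) \<Rightarrow> (nat \<times> nat) list \<Rightarrow> bool list" where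
  "answers \<pi> qs = map (\<lambda>(x, y). \<pi> x < \<pi> y) qs"

primrec run :: "(nat \<Rightarrow> nat) \<Rightarrow> algorithm \<Rightarrow> nat set \<times> nat set" where
  "run \<pi> (Output A R) = (A, R)"
| "run \<pi> (Round qs k) = run \<pi> (k (answers \<pi> qs))"

primrec num_rounds :: "(nat \<Rightarrow> nat) \<Rightarrow> algorithm \<Rightarrow> nat" where
  "num_rounds \<pi> (Output A R) = 0"
| "num_rounds \<pi> (Round qs k) = Suc (num_rounds \<pi> (k (answers \<pi> qs)))"

primrec num_queries :: "(nat \<Rightarrow> nat) \<Rightarrow> algorithm \<Rightarrow> nat" where
  "num_queries \<pi> (Output A R) = 0"
| "num_queries \<pi> (Round qs k) = length qs + num_queries \<pi> (k (answers \<pi> qs))"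

text \<open>
  On input \<open>\<pi>\<close>, only elements of the input are compared, and the output is a partition of them.
\<close>

primrec legal_run :: "nat \<Rightarrow> (nat \<Rightarrow> nat) \<Rightarrow> algorithm \<Rightarrow> bool" where
  "legal_run n \<pi> (Output A R) \<longleftrightarrow> A \<union> R = {1..n} \<and> A \<inter> R = {}"
| "legal_run n \<pi> (Round qs k) \<longleftrightarrow>
     set qs \<subseteq> {1..n} \<times> {1..n} \<and> legal_run n \<pi> (k (answers \<pi> qs))"

definition inputs :: "nat \<Rightarrow> (nat \<Rightarrow> nat) set" where
  "inputs n = {\<pi>. \<pi> permutes {1..n}}"

text \<open>
  A randomized algorithm for inputs of size \<open>n\<close> is a probability distribution on deterministic
  ones: all coins are tossed in advance. Round and query complexity are worst-case, over
  all inputs and all coin tosses.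
\<close>

definition partition_algorithm :: "nat \<Rightarrow> algorithm pmf \<Rightarrow> bool" where
  "partition_algorithm n P \<longleftrightarrow> (\<forall>D \<in> set_pmf P. \<forall>\<pi> \<in> inputs n. legal_run n \<pi> D)"

definition rounds_at_most :: "nat \<Rightarrow> algorithm pmf \<Rightarrow> nat \<Rightarrow> bool" where
  "rounds_at_most n P r \<longleftrightarrow> (\<forall>D \<in> set_pmf P. \<forall>\<pi> \<in> inputs n. num_rounds \<pi> D \<le> r)"

definition queries_at_most :: "nat \<Rightarrow> algorithm pmf \<Rightarrow> real \<Rightarrow> bool" where
  "queries_at_most n P q \<longleftrightarrow> (\<forall>D \<in> set_pmf P. \<forall>\<pi> \<in> inputs n. real (num_queries \<pi> D) \<le> q)"

text \<open>
  The sums range over ranks \<open>i\<close>, so \<open>i \<in> \<pi> ` R\<close> says that the \<open>i\<close>-th smallest element is in \<open>R\<close>.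
  The comparison with \<open>n / 2\<close> is in the reals; the base of \<open>powr\<close> is never \<open>0\<close>, so \<open>c = 0\<close>
  counts the misplaced elements.
\<close>

definition weighted_error :: "nat \<Rightarrow> real \<Rightarrow> (nat \<Rightarrow> nat) \<Rightarrow> nat set \<times> nat set \<Rightarrow> real" where
  "weighted_error n c \<pi> = (\<lambda>(A, R).
     (\<Sum>i | i \<in> {1..n} \<and> real i > real n / 2.
        of_bool (i \<in> \<pi> ` R) * \<bar>real i - real n / 2\<bar> powr c) +
     (\<Sum>i | i \<in> {1..n} \<and> real i < real n / 2.
        of_bool (i \<in> \<pi> ` A) * \<bar>real i - real n / 2\<bar> powr c))"

text \<open>
  The probability is over the uniformly random input order and, independently, the coins.
\<close>

definition zero_error_prob :: "nat \<Rightarrow> real \<Rightarrow> algorithm pmf \<Rightarrow> real" where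
  "zero_error_prob n c P =
     measure_pmf.prob (pair_pmf (pmf_of_set (inputs n)) P)
       {(\<pi>, D). weighted_error n c \<pi> (run \<pi> D) = 0}"

end

theory Submission
  imports Defs
begin

text \<open>
  The coins are \<open>q\<^sup>1\<^sup>2\<close> labels drawn independently and uniformly, where \<open>q \<approx> n powr (1 / 18)\<close>.
  Round 1 compares the first \<open>q\<^sup>6\<close> of them with all of them, which estimates the ranks of these
  pivots up to \<open>O(n / q\<^sup>5)\<close>; as they are dense enough, two of them enclose the median in a window of
  \<open>O(n / q\<^sup>5)\<close> ranks. Round 2 compares everything with these two. Round 3 compares the window with the
  \<open>O(q\<^sup>5)\<close> sampled labels among the first \<open>q\<^sup>1\<^sup>0\<close> that fall into it; their ranks are now known
  exactly, and the two next to the median are at most \<open>O(n / q\<^sup>9) = O(\<surd>n)\<close> ranks apart.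
  Round 4 sorts what lies between. Each failure event is a tail of a sum of independent indicators
  and has probability at most \<open>exp (- q / 4)\<close>.
\<close>

section \<open>Round-based strategies\<close>

text \<open>A request exceeding the budget \<open>b\<close> is dropped, so that the query bound holds on every input.\<close>

definition queries :: "nat \<Rightarrow> nat \<Rightarrow> (nat \<times> nat) set \<Rightarrow> (nat \<times> nat) list" where
  "queries n b S =
     (let qs = filter (\<lambda>p. p \<in> S \<union> S\<inverse>) (List.product [1..<Suc n] [1..<Suc n])
      in if length qs \<le> b then qs else [])"

text \<open>Negative answers are discarded. Nothing is lost, since \<open>queries\<close> asks each
  of its pairs in both directions, so of two distinct compared elements one order is
  confirmed.\<close>

definition confirmed :: "(nat \<times> nat) list \<Rightarrow> bool list \<Rightarrow> (nat \<times> nat) set" where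
  "confirmed qs bs = {p. (p, True) \<in> set (zip qs bs)}"

text \<open>Only a lower bound on the rank, unless all elements below \<open>x\<close> are known to be so.\<close>

definition known_rank :: "(nat \<times> nat) set \<Rightarrow> nat \<Rightarrow> nat" where
  "known_rank K x = Suc (card {y. (y, x) \<in> K\<^sup>+})"

text \<open>A strategy maps the pairs confirmed so far to its next request; the transcript enters
  only through \<open>K\<close>.\<close>

primrec play ::
  "nat \<Rightarrow> nat \<Rightarrow> ((nat \<times> nat) set \<Rightarrow> (nat \<times> nat) set) list \<Rightarrow> (nat \<times> nat) set \<Rightarrow> algorithm" where
  "play n b [] K =
     Output {x \<in> {1..n}. n < 2 * known_rank K x} {x \<in> {1..n}. \<not> n < 2 * known_rank K x}"
| "play n b (s # ss) K =
     Round (queries n b (s K)) (\<lambda>bs. play n b ss (K \<union> confirmed (queries n b (s K)) bs))"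

definition less_pairs :: "nat \<Rightarrow> (nat \<Rightarrow> nat) \<Rightarrow> (nat \<times> nat) set" where
  "less_pairs n \<pi> = {(x, y). x \<in> {1..n} \<and> y \<in> {1..n} \<and> \<pi> x < \<pi> y}"

text \<open>The final knowledge of \<open>play\<close>, written with \<open>\<pi>\<close> in place
  of answer lists so that no continuations occur in the correctness argument.\<close>

primrec learn :: "nat \<Rightarrow> nat \<Rightarrow> (nat \<Rightarrow> nat) \<Rightarrow> ((nat \<times> nat) set \<Rightarrow> (nat \<times> nat) set) list \<Rightarrow>
    (nat \<times> nat) set \<Rightarrow> (nat \<times> nat) set" where
  "learn n b \<pi> [] K = K"
| "learn n b \<pi> (s # ss) K = learn n b \<pi> ss (K \<union> {(x, y) \<in> set (queries n b (s K)). \<pi> x < \<pi> y})"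

lemma set_queries: "set (queries n b S) \<subseteq> {1..n} \<times> {1..n}"
  by (auto simp: queries_def Let_def)

lemma length_queries: "length (queries n b S) \<le> b"
  by (auto simp: queries_def Let_def)

lemma confirmed_answers: "confirmed qs (answers \<pi> qs) = {(x, y) \<in> set qs. \<pi> x < \<pi> y}"
proof -
  have "zip qs (answers \<pi> qs) = map (\<lambda>p. (p, case p of (x, y) \<Rightarrow> \<pi> x < \<pi> y)) qs"
    by (simp add: answers_def zip_map2 zip_same_conv_map)
  then show ?thesis by (auto simp: confirmed_def)
qed

lemma legal_run_play: "legal_run n \<pi> (play n b ss K)"
proof (induction ss arbitrary: K)
  case (Cons s ss)
  then show ?case using set_queries[of n b "s K"] by simp
qed auto

lemma num_rounds_play: "num_rounds \<pi> (play n b ss K) = length ss"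
  by (induction ss arbitrary: K) auto

lemma num_queries_play: "num_queries \<pi> (play n b ss K) \<le> b * length ss"
proof (induction ss arbitrary: K)
  case (Cons s ss)
  have "num_queries \<pi> (play n b (s # ss) K) \<le> b + b * length ss"
    using add_mono[OF length_queries Cons.IH] by simp
  then show ?case by simp
qed simp

lemma run_play:
  "run \<pi> (play n b ss K) =
     ({x \<in> {1..n}. n < 2 * known_rank (learn n b \<pi> ss K) x},
      {x \<in> {1..n}. \<not> n < 2 * known_rank (learn n b \<pi> ss K) x})"
  by (induction ss arbitrary: K) (auto simp: confirmed_answers)

text \<open>Asking both directions at most doubles the number of pairs, hence
  \<open>2 * c\<close>.\<close>

lemma queries_within_budget:
  assumes "card S \<le> c" "2 * c \<le> b" "finite S"
  shows "set (queries n b S) = (S \<union> S\<inverse>) \<inter> {1..n} \<times> {1..n}"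
proof -
  let ?qs = "filter (\<lambda>p. p \<in> S \<union> S\<inverse>) (List.product [1..<Suc n] [1..<Suc n])"
  have "length ?qs = card (set ?qs)"
    by (rule distinct_card[symmetric]) (intro distinct_filter distinct_product distinct_upt)
  also have "\<dots> \<le> card (S \<union> S\<inverse>)"
    using assms by (intro card_mono) auto
  also have "\<dots> \<le> card S + card (S\<inverse>)" by (rule card_Un_le)
  also have "card (S\<inverse>) = card S" by simp
  finally have "length ?qs \<le> b" using assms by linarith
  then show ?thesis by (auto simp: queries_def Let_def)
qed

section \<open>The true order, ranks and the error\<close>

lemma trans_less_pairs: "trans (less_pairs n \<pi>)"
  by (auto simp: less_pairs_def trans_def)

lemma finite_less_pairs: "finite (less_pairs n \<pi>)"
  by (rule finite_subset[of _ "{1..n} \<times> {1..n}"]) (auto simp: less_pairs_def)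

lemma finite_trancl_below: "finite K \<Longrightarrow> finite {y. (y, x) \<in> K\<^sup>+}"
  by (rule finite_subset[of _ "Domain (K\<^sup>+)"]) (blast, simp add: finite_Domain)

lemma known_rank_mono:
  assumes "K \<subseteq> K'" "finite K'"
  shows "known_rank K x \<le> known_rank K' x"
  unfolding known_rank_def
  using trancl_mono[OF _ assms(1)] finite_trancl_below[OF assms(2)] by (auto intro!: card_mono)

text \<open>\<open>\<pi>\<close> is a bijection of \<open>{1..n}\<close>, so counting labels by rank
  is counting ranks.\<close>

lemma card_rank_in:
  assumes "\<pi> permutes {1..n}"
  shows "card {x \<in> {1..n}. \<pi> x \<in> R} = card (R \<inter> {1..n})"
proof -
  have "card {x \<in> {1..n}. \<pi> x \<in> R} = card (\<pi> ` {x \<in> {1..n}. \<pi> x \<in> R})"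
    by (rule card_image[symmetric]) (rule inj_on_subset[OF permutes_inj[OF assms]], simp)
  also have "\<pi> ` {x \<in> {1..n}. \<pi> x \<in> R} = R \<inter> \<pi> ` {1..n}" by auto
  finally show ?thesis by (simp only: permutes_image[OF assms])
qed

lemma card_rank_between:
  assumes "\<pi> permutes {1..n}"
  shows "card {x \<in> {1..n}. r < \<pi> x \<and> \<pi> x \<le> s} \<le> s - r"
proof -
  have "card ({r<..s} \<inter> {1..n}) \<le> card {r<..s}" by (rule card_mono) auto
  then show ?thesis using card_rank_in[OF assms, of "{r<..s}"] by simp
qed

lemma card_rank_less:
  assumes "\<pi> permutes {1..n}" "r \<le> Suc n"
  shows "card {x \<in> {1..n}. \<pi> x < r} = r - 1"
proof -
  have "{..<r} \<inter> {1..n} = {1..<r}" using assms(2) by auto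
  then show ?thesis using card_rank_in[OF assms(1), of "{..<r}"] by simp
qed

lemma known_rank_less_pairs:
  assumes "\<pi> permutes {1..n}" "x \<in> {1..n}"
  shows "known_rank (less_pairs n \<pi>) x = \<pi> x"
proof -
  have "\<pi> x \<in> {1..n}" using assms permutes_in_image by metis
  moreover have "{y. (y, x) \<in> (less_pairs n \<pi>)\<^sup>+} = {y \<in> {1..n}. \<pi> y < \<pi> x}"
    using assms by (auto simp: trancl_id[OF trans_less_pairs]) (auto simp: less_pairs_def)
  ultimately show ?thesis
    using card_rank_less[OF assms(1), of "\<pi> x"] by (simp add: known_rank_def)
qed

text \<open>For even \<open>n\<close>, the rank \<open>n div 2\<close> occurs in neither sum of the
  error, so rejecting that element is harmless.\<close>

lemma weighted_error_eq_0:
  assumes "\<pi> permutes {1..n}"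
    and "\<And>x. x \<in> {1..n} \<Longrightarrow> x \<in> A \<longleftrightarrow> n < 2 * \<pi> x"
    and "\<And>x. x \<in> {1..n} \<Longrightarrow> x \<in> R \<longleftrightarrow> \<not> n < 2 * \<pi> x"
    and "A \<subseteq> {1..n}" "R \<subseteq> {1..n}"
  shows "weighted_error n c \<pi> (A, R) = 0"
proof -
  have "i \<notin> \<pi> ` R" if "real i > real n / 2" for i
  proof
    assume "i \<in> \<pi> ` R"
    then obtain x where x: "x \<in> R" "i = \<pi> x" by auto
    then have "\<not> n < 2 * i" using assms(3)[of x] assms(5) by auto
    then show False using that by linarith
  qed
  moreover have "i \<notin> \<pi> ` A" if "real i < real n / 2" for i
  proof
    assume "i \<in> \<pi> ` A"
    then obtain x where x: "x \<in> A" "i = \<pi> x" by auto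
    then have "n < 2 * i" using assms(2)[of x] assms(4) by auto
    then show False using that by linarith
  qed
  ultimately show ?thesis by (simp add: weighted_error_def sum.neutral)
qed

text \<open>Rejecting everything not known to be large means that only the elements above the median
  can be misplaced; these need no more than the elements of rank at most \<open>n div 2\<close> below them.\<close>

lemma weighted_error_play:
  assumes \<pi>: "\<pi> permutes {1..n}"
    and sub: "learn n b \<pi> ss K \<subseteq> less_pairs n \<pi>"
    and cut: "\<And>x y. x \<in> {1..n} \<Longrightarrow> y \<in> {1..n} \<Longrightarrow> \<pi> y \<le> n div 2 \<Longrightarrow> n div 2 < \<pi> x \<Longrightarrow>
      (y, x) \<in> (learn n b \<pi> ss K)\<^sup>+"
  shows "weighted_error n c \<pi> (run \<pi> (play n b ss K)) = 0"
proof -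
  let ?K = "learn n b \<pi> ss K"
  have "n < 2 * known_rank ?K x \<longleftrightarrow> n < 2 * \<pi> x" if x: "x \<in> {1..n}" for x
  proof
    assume "n < 2 * known_rank ?K x"
    moreover have "known_rank ?K x \<le> \<pi> x"
      using known_rank_mono[OF sub finite_less_pairs] known_rank_less_pairs[OF \<pi> x] by metis
    ultimately show "n < 2 * \<pi> x" by linarith
  next
    assume "n < 2 * \<pi> x"
    then have px: "n div 2 < \<pi> x" by linarith
    have fin: "finite {y. (y, x) \<in> ?K\<^sup>+}"
      by (rule finite_trancl_below[OF finite_subset[OF sub finite_less_pairs]])
    \<comment> \<open>Knowing the whole lower half to be below \<open>x\<close> makes the known rank
      at least \<open>n div 2 + 1\<close>, which exceeds \<open>n / 2\<close> for either
      parity.\<close>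
    have "n div 2 = card {y \<in> {1..n}. \<pi> y < Suc (n div 2)}"
      by (subst card_rank_less[OF \<pi>]) (simp_all add: subset_iff)
    also have "\<dots> \<le> card {y. (y, x) \<in> ?K\<^sup>+}"
    proof (rule card_mono[OF fin], rule subsetI)
      fix y assume "y \<in> {y \<in> {1..n}. \<pi> y < Suc (n div 2)}"
      then have "(y, x) \<in> ?K\<^sup>+" by (intro cut x px) simp_all
      then show "y \<in> {y. (y, x) \<in> ?K\<^sup>+}" ..
    qed
    finally have "2 * Suc (n div 2) \<le> 2 * known_rank ?K x" by (simp add: known_rank_def)
    moreover have "n < 2 * Suc (n div 2)" by presburger
    ultimately show "n < 2 * known_rank ?K x" by (rule order.strict_trans2[rotated])
  qed
  then show ?thesis
    unfolding run_play by (intro weighted_error_eq_0[OF \<pi>]) (simp_all add: subset_iff)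
qed

section \<open>Independent samples\<close>

text \<open>Giving the indices outside \<open>J\<close> the constant factor \<open>1\<close> reduces
  this to the product formula over all of \<open>A\<close>; the bound \<open>B\<close> provides
  integrability.\<close>

lemma expectation_prod_iid:
  fixes f :: "'b \<Rightarrow> real" and p :: "'b pmf" and d :: 'b
  assumes "finite A" "J \<subseteq> A" "\<And>x. 0 \<le> f x" "\<And>x. f x \<le> B"
  shows "integrable (measure_pmf (Pi_pmf A d (\<lambda>_. p))) (\<lambda>\<omega>. \<Prod>j\<in>J. f (\<omega> j))"
    and "measure_pmf.expectation (Pi_pmf A d (\<lambda>_. p)) (\<lambda>\<omega>. \<Prod>j\<in>J. f (\<omega> j)) =
      measure_pmf.expectation p f ^ card J"
proof -
  let ?\<Omega> = "Pi_pmf A d (\<lambda>_. p)"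
  show "integrable (measure_pmf ?\<Omega>) (\<lambda>\<omega>. \<Prod>j\<in>J. f (\<omega> j))"
  proof (rule measure_pmf.integrable_const_bound[of _ "B ^ card J"])
    have "(\<Prod>j\<in>J. f (\<omega> j)) \<le> B ^ card J" for \<omega>
      using prod_mono[of J "\<lambda>j. f (\<omega> j)" "\<lambda>_. B"] assms(3,4) by simp
    then show "AE \<omega> in measure_pmf ?\<Omega>. norm (\<Prod>j\<in>J. f (\<omega> j)) \<le> B ^ card J"
      using assms(3) by (simp add: prod_nonneg)
  qed simp
  define g where "g j = (if j \<in> J then f else (\<lambda>_. 1))" for j
  have int: "integrable (measure_pmf p) f"
    by (rule measure_pmf.integrable_const_bound[of _ B]) (use assms(3,4) in auto)
  have "measure_pmf.expectation ?\<Omega> (\<lambda>\<omega>. \<Prod>j\<in>A. g j (\<omega> j)) =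
      (\<Prod>j\<in>A. measure_pmf.expectation p (g j))"
    by (rule expectation_prod_Pi_pmf) (use assms(1,3) int in \<open>auto simp: g_def\<close>)
  also have "(\<lambda>\<omega>. \<Prod>j\<in>A. g j (\<omega> j)) = (\<lambda>\<omega>. \<Prod>j\<in>J. f (\<omega> j))"
    by (rule ext, rule prod.mono_neutral_cong_right) (use assms(1,2) in \<open>auto simp: g_def\<close>)
  also have "(\<Prod>j\<in>A. measure_pmf.expectation p (g j)) = (\<Prod>j\<in>J. measure_pmf.expectation p f)"
    by (rule prod.mono_neutral_cong_right) (use assms(1,2) in \<open>auto simp: g_def\<close>)
  finally show "measure_pmf.expectation ?\<Omega> (\<lambda>\<omega>. \<Prod>j\<in>J. f (\<omega> j)) =
      measure_pmf.expectation p f ^ card J" by simp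
qed

text \<open>By independence the probability is \<open>(1 - p) ^ card J\<close>, and
  \<open>1 - p \<le> exp (- p)\<close>.\<close>

lemma prob_sample_misses:
  fixes p :: "'b pmf"
  assumes "finite A" "J \<subseteq> A"
  shows "measure_pmf.prob (Pi_pmf A d (\<lambda>_. p)) {\<omega>. \<forall>j\<in>J. \<omega> j \<notin> I}
    \<le> exp (- (measure_pmf.prob p I * real (card J)))"
proof -
  let ?\<Omega> = "Pi_pmf A d (\<lambda>_. p)"
  have "finite J" using assms by (rule rev_finite_subset)
  then have "indicator {\<omega>. \<forall>j\<in>J. \<omega> j \<notin> I} \<omega> = (\<Prod>j\<in>J. indicator (- I) (\<omega> j) :: real)" for \<omega>
    by (auto simp: indicator_def)
  then have "indicator {\<omega>. \<forall>j\<in>J. \<omega> j \<notin> I} = (\<lambda>\<omega>. \<Prod>j\<in>J. indicator (- I) (\<omega> j) :: real)" ..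
  moreover have "measure_pmf.prob ?\<Omega> {\<omega>. \<forall>j\<in>J. \<omega> j \<notin> I} =
      measure_pmf.expectation ?\<Omega> (indicator {\<omega>. \<forall>j\<in>J. \<omega> j \<notin> I})" by simp
  ultimately have "measure_pmf.prob ?\<Omega> {\<omega>. \<forall>j\<in>J. \<omega> j \<notin> I} =
      measure_pmf.expectation ?\<Omega> (\<lambda>\<omega>. \<Prod>j\<in>J. indicator (- I) (\<omega> j))" by (simp only:)
  also have "\<dots> = measure_pmf.expectation p (indicator (- I)) ^ card J"
    by (rule expectation_prod_iid(2)[OF assms, where B = 1]) (auto simp: indicator_def)
  also have "measure_pmf.expectation p (indicator (- I)) = 1 - measure_pmf.prob p I"
    by (simp add: measure_pmf.prob_compl[of I p, simplified] Compl_eq_Diff_UNIV)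
  also have "(1 - measure_pmf.prob p I) ^ card J \<le> exp (- measure_pmf.prob p I) ^ card J"
    using exp_ge_add_one_self[of "- measure_pmf.prob p I"] by (intro power_mono) auto
  also have "\<dots> = exp (- (measure_pmf.prob p I * real (card J)))"
    by (simp add: exp_of_nat2_mult[symmetric])
  finally show ?thesis .
qed

text \<open>Chernoff's method: Markov's inequality for the exponential of \<open>l\<close> times the
  count, whose factors have mean \<open>1 + p * (exp l - 1)\<close>, with
  \<open>exp l - 1 \<le> l + l\<^sup>2\<close> on the unit interval.\<close>

lemma prob_sample_count_ge:
  fixes p :: "'b pmf"
  assumes "finite A" "J \<subseteq> A" "0 \<le> l" "l \<le> 1"
  shows "measure_pmf.prob (Pi_pmf A d (\<lambda>_. p)) {\<omega>. s \<le> real (card {j \<in> J. \<omega> j \<in> I})}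
    \<le> exp (measure_pmf.prob p I * (l + l\<^sup>2) * real (card J) - l * s)"
proof -
  let ?\<Omega> = "Pi_pmf A d (\<lambda>_. p)" and ?p = "measure_pmf.prob p I"
  let ?f = "\<lambda>x. exp (l * indicator I x)"
  have "finite J" using assms(1,2) by (rule rev_finite_subset)
  then have prod: "(\<Prod>j\<in>J. ?f (\<omega> j)) = exp (l * real (card {j \<in> J. \<omega> j \<in> I}))" for \<omega>
    by (simp add: exp_sum[symmetric] sum_distrib_left[symmetric] indicator_def
        sum.inter_filter[symmetric] Int_def flip: of_bool_def)
  have f: "0 \<le> ?f x" "?f x \<le> exp l" for x using assms(3) by (auto simp: indicator_def)
  note E = expectation_prod_iid[where f = ?f and B = "exp l" and p = p and d = d, OF assms(1,2) f]
  have "measure_pmf.prob ?\<Omega> {\<omega>. s \<le> real (card {j \<in> J. \<omega> j \<in> I})} \<le>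
      measure_pmf.prob ?\<Omega> {\<omega>. exp (l * s) \<le> (\<Prod>j\<in>J. ?f (\<omega> j))}"
    unfolding prod by (intro measure_pmf.finite_measure_mono)
      (use assms(3) in \<open>auto intro: mult_left_mono\<close>)
  also have "\<dots> \<le> measure_pmf.expectation ?\<Omega> (\<lambda>\<omega>. \<Prod>j\<in>J. ?f (\<omega> j)) / exp (l * s)"
    using integral_Markov_inequality_measure[OF E(1), where A = "{}" and c = "exp (l * s)"]
    by (simp add: prod_nonneg)
  also have "\<dots> = measure_pmf.expectation p ?f ^ card J / exp (l * s)"
    by (simp only: E(2))
  also have "measure_pmf.expectation p ?f = 1 + ?p * (exp l - 1)"
  proof -
    have "?f = (\<lambda>x. 1 + indicator I x * (exp l - 1))"
      by (auto simp: indicator_def)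
    moreover have "integrable (measure_pmf p) (\<lambda>x. indicator I x * (exp l - 1))"
      by (intro integrable_mult_left measure_pmf.integrable_const_bound[where B = 1]) auto
    ultimately show ?thesis by simp
  qed
  also have "\<dots> ^ card J \<le> exp (?p * (l + l\<^sup>2)) ^ card J"
  proof (rule power_mono)
    have "exp l - 1 \<le> l + l\<^sup>2" using exp_bound[OF assms(3,4)] by simp
    then have "1 + ?p * (exp l - 1) \<le> 1 + ?p * (l + l\<^sup>2)" by (simp add: mult_left_mono)
    also have "\<dots> \<le> exp (?p * (l + l\<^sup>2))" by (rule exp_ge_add_one_self)
    finally show "1 + ?p * (exp l - 1) \<le> exp (?p * (l + l\<^sup>2))" .
  qed (use assms(3) in simp)
  also have "\<dots> = exp (?p * (l + l\<^sup>2) * real (card J))"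
    by (simp add: exp_of_nat2_mult[symmetric])
  finally show ?thesis by (simp add: exp_diff divide_right_mono)
qed

text \<open>The coins are independent of the input, so a failure bound for each fixed input survives
  averaging over the inputs.\<close>

lemma zero_error_prob_ge:
  assumes "\<And>\<pi>. \<pi> permutes {1..n} \<Longrightarrow>
    measure_pmf.prob \<Omega> {\<omega>. weighted_error n c \<pi> (run \<pi> (D \<omega>)) \<noteq> 0} \<le> \<eta>"
  shows "zero_error_prob n c (map_pmf D \<Omega>) \<ge> 1 - \<eta>"
proof -
  let ?M = "pair_pmf (pmf_of_set (inputs n)) (map_pmf D \<Omega>)"
  let ?S = "{(\<pi>, D). weighted_error n c \<pi> (run \<pi> D) = 0}"
  have fin: "finite (inputs n)" "inputs n \<noteq> {}"
    using permutes_id[of "{1..n}"] by (auto simp: inputs_def finite_permutations simp del: permutes_id)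
  \<comment> \<open>The instance at the identity yields \<open>0 \<le> \<eta>\<close>, needed to
    return from \<open>ennreal\<close> to the reals at the end.\<close>
  have "measure_pmf.prob \<Omega> {\<omega>. weighted_error n c id (run id (D \<omega>)) \<noteq> 0} \<le> \<eta>"
    by (rule assms) (rule permutes_id)
  then have "0 \<le> \<eta>" using measure_nonneg order_trans by blast
  have "emeasure ?M (- ?S) = (\<integral>\<^sup>+ \<pi>. emeasure (map_pmf D \<Omega>) {D. (\<pi>, D) \<in> - ?S} \<partial>pmf_of_set (inputs n))"
    by (simp add: pair_pmf_def vimage_def flip: map_pmf_def)
  also have "\<dots> \<le> (\<integral>\<^sup>+ \<pi>. ennreal \<eta> \<partial>pmf_of_set (inputs n))"
  proof (rule nn_integral_mono_AE, rule AE_pmfI)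
    fix \<pi> assume "\<pi> \<in> set_pmf (pmf_of_set (inputs n))"
    then have "\<pi> permutes {1..n}" using fin by (simp add: inputs_def)
    then show "emeasure (map_pmf D \<Omega>) {D. (\<pi>, D) \<in> - ?S} \<le> ennreal \<eta>"
      using assms[of \<pi>] by (simp add: measure_pmf.emeasure_eq_measure vimage_def ennreal_leI)
  qed
  also have "\<dots> = ennreal \<eta>" by simp
  finally have "measure_pmf.prob ?M (- ?S) \<le> \<eta>"
    using \<open>0 \<le> \<eta>\<close> by (simp add: measure_pmf.emeasure_eq_measure)
  then show ?thesis
    unfolding zero_error_prob_def using measure_pmf.prob_compl[of ?S ?M]
    by (simp add: Compl_eq_Diff_UNIV)
qed

section \<open>The four rounds on a good sample\<close>

text \<open>Only a confirmed strict inequality excludes an element. Once \<open>X\<close> is sorted,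
  \<open>L = X\<close> with \<open>H = {}\<close> selects its maximum, and \<open>L = {}\<close>
  with \<open>H = X\<close> its minimum.\<close>

definition enclosed :: "nat set \<Rightarrow> nat set \<Rightarrow> nat set \<Rightarrow> (nat \<times> nat) set \<Rightarrow> nat set" where
  "enclosed X L H K = {x \<in> X. (\<forall>p\<in>L. (x, p) \<notin> K) \<and> (\<forall>p\<in>H. (p, x) \<notin> K)}"

text \<open>Indices are counted, not labels, so that for a fixed rank threshold such counts are sums
  of independent indicators. Scaled by \<open>n / q ^ 12\<close>, this estimates the number of
  elements below \<open>a\<close>.\<close>

definition below_count :: "nat \<Rightarrow> (nat \<Rightarrow> nat) \<Rightarrow> (nat \<times> nat) set \<Rightarrow> nat \<Rightarrow> nat" where
  "below_count q \<omega> K a = card {j. j < q ^ 12 \<and> (\<omega> j, a) \<in> K}"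

text \<open>The margin \<open>q ^ 7\<close> exceeds the standard deviation of the counts by a factor of order \<open>q\<close>.\<close>

definition low_pivots :: "nat \<Rightarrow> nat \<Rightarrow> (nat \<Rightarrow> nat) \<Rightarrow> (nat \<times> nat) set \<Rightarrow> nat set" where
  "low_pivots n q \<omega> K =
     {a \<in> \<omega> ` {..<q ^ 6}. n * below_count q \<omega> K a + n * q ^ 7 \<le> q ^ 12 * (n div 2)}"

definition high_pivots :: "nat \<Rightarrow> nat \<Rightarrow> (nat \<Rightarrow> nat) \<Rightarrow> (nat \<times> nat) set \<Rightarrow> nat set" where
  "high_pivots n q \<omega> K =
     {b \<in> \<omega> ` {..<q ^ 6}. q ^ 12 * (n div 2) + n * q ^ 7 \<le> n * below_count q \<omega> K b}"

text \<open>A set instead of an element, so that the absence of a suitable pivot needs no special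
  case; on a good sample it is a singleton.\<close>

definition lower_end :: "nat \<Rightarrow> nat \<Rightarrow> (nat \<Rightarrow> nat) \<Rightarrow> (nat \<times> nat) set \<Rightarrow> nat set" where
  "lower_end n q \<omega> K = enclosed (low_pivots n q \<omega> K) (low_pivots n q \<omega> K) {} K"

definition upper_end :: "nat \<Rightarrow> nat \<Rightarrow> (nat \<Rightarrow> nat) \<Rightarrow> (nat \<times> nat) set \<Rightarrow> nat set" where
  "upper_end n q \<omega> K = enclosed (high_pivots n q \<omega> K) {} (high_pivots n q \<omega> K) K"

definition middle :: "nat \<Rightarrow> nat \<Rightarrow> (nat \<Rightarrow> nat) \<Rightarrow> (nat \<times> nat) set \<Rightarrow> nat set" where
  "middle n q \<omega> K = enclosed {1..n} (lower_end n q \<omega> K) (upper_end n q \<omega> K) K"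

text \<open>Restricting to \<open>q ^ 10\<close> samples leaves only \<open>O(q ^ 5)\<close> of them
  in a window of \<open>O(n / q ^ 5)\<close> ranks, so that comparing the two sets costs
  \<open>O(n)\<close>.\<close>

definition middle_pivots :: "nat \<Rightarrow> nat \<Rightarrow> (nat \<Rightarrow> nat) \<Rightarrow> (nat \<times> nat) set \<Rightarrow> nat set" where
  "middle_pivots n q \<omega> K =
     (\<omega> ` {..<q ^ 10} \<union> lower_end n q \<omega> K \<union> upper_end n q \<omega> K) \<inter> middle n q \<omega> K"

text \<open>On a good sample the pivot ranks are exact by now, so \<open>known_rank\<close> decides
  their side of the median. What remains lies between the two pivots next to the median, these
  included.\<close>

definition core :: "nat \<Rightarrow> nat \<Rightarrow> (nat \<Rightarrow> nat) \<Rightarrow> (nat \<times> nat) set \<Rightarrow> nat set" where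
  "core n q \<omega> K = enclosed (middle n q \<omega> K)
     {p \<in> middle_pivots n q \<omega> K. known_rank K p \<le> n div 2}
     {p \<in> middle_pivots n q \<omega> K. n div 2 < known_rank K p} K"

text \<open>On a good sample the requests have at most \<open>q ^ 18\<close>, \<open>2 * n\<close>,
  \<open>O(n / q ^ 5) * O(q ^ 5)\<close> and \<open>O(n / q ^ 9) ^ 2\<close> pairs, all linear in
  \<open>n\<close> when \<open>n\<close> is of order \<open>q ^ 18\<close>.\<close>

definition strategies :: "nat \<Rightarrow> nat \<Rightarrow> (nat \<Rightarrow> nat) \<Rightarrow> ((nat \<times> nat) set \<Rightarrow> (nat \<times> nat) set) list"
  where "strategies n q \<omega> =
    [\<lambda>K. \<omega> ` {..<q ^ 6} \<times> \<omega> ` {..<q ^ 12},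
     \<lambda>K. {1..n} \<times> (lower_end n q \<omega> K \<union> upper_end n q \<omega> K),
     \<lambda>K. middle n q \<omega> K \<times> middle_pivots n q \<omega> K,
     \<lambda>K. core n q \<omega> K \<times> core n q \<omega> K]"

text \<open>On a set of resolved pairs, what the algorithm computes from its knowledge \<open>K\<close> is what it would
  compute from the whole order \<open>less_pairs n \<pi>\<close>.\<close>

definition resolved :: "nat \<Rightarrow> (nat \<Rightarrow> nat) \<Rightarrow> (nat \<times> nat) set \<Rightarrow> (nat \<times> nat) set \<Rightarrow> bool" where
  "resolved n \<pi> S K \<longleftrightarrow> K \<subseteq> less_pairs n \<pi> \<and> less_pairs n \<pi> \<inter> (S \<union> S\<inverse>) \<subseteq> K"

lemma resolved_iff:
  assumes "resolved n \<pi> S K" "(x, y) \<in> S \<or> (y, x) \<in> S"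
  shows "(x, y) \<in> K \<longleftrightarrow> (x, y) \<in> less_pairs n \<pi>"
  using assms by (auto simp: resolved_def)

lemma resolved_mono:
  "resolved n \<pi> S K \<Longrightarrow> K \<subseteq> K' \<Longrightarrow> K' \<subseteq> less_pairs n \<pi> \<Longrightarrow> resolved n \<pi> S K'"
  by (auto simp: resolved_def)

lemma resolved_step:
  assumes "K \<subseteq> less_pairs n \<pi>" "card S \<le> c" "2 * c \<le> b" "finite S"
  shows "resolved n \<pi> S (K \<union> {(x, y) \<in> set (queries n b S). \<pi> x < \<pi> y})"
  unfolding queries_within_budget[OF assms(2-4)] resolved_def
  using assms(1) by (auto simp: less_pairs_def)

lemma enclosed_less_pairs:
  assumes "X \<subseteq> {1..n}" "L \<subseteq> {1..n}" "H \<subseteq> {1..n}"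
  shows "enclosed X L H (less_pairs n \<pi>) =
    {x \<in> X. (\<forall>p\<in>L. \<pi> p \<le> \<pi> x) \<and> (\<forall>p\<in>H. \<pi> x \<le> \<pi> p)}"
  using assms by (fastforce simp: enclosed_def less_pairs_def not_less)

text \<open>Membership depends only on pairs between \<open>X\<close> and the bounds.\<close>

lemma enclosed_resolved:
  assumes "resolved n \<pi> S K" "X \<times> (L \<union> H) \<subseteq> S"
  shows "enclosed X L H K = enclosed X L H (less_pairs n \<pi>)"
proof -
  have "(x, p) \<in> K \<longleftrightarrow> (x, p) \<in> less_pairs n \<pi>" if "x \<in> X" "p \<in> L" for x p
    by (rule resolved_iff[OF assms(1)]) (use assms(2) that in auto)
  moreover have "(p, x) \<in> K \<longleftrightarrow> (p, x) \<in> less_pairs n \<pi>" if "x \<in> X" "p \<in> H" for x p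
    by (rule resolved_iff[OF assms(1)]) (use assms(2) that in auto)
  ultimately show ?thesis by (auto simp: enclosed_def)
qed

text \<open>All that is required of the random sample, so that correctness becomes deterministic.
  \<open>tail1\<close> and \<open>tail2\<close> stop pivots on the wrong side of the median from
  passing the tests, \<open>tail3\<close> and \<open>tail4\<close> let pivots beyond distance
  \<open>w1\<close> pass, and the \<open>hit\<close> conditions supply pivots between the distances
  \<open>w1\<close> and \<open>w\<close> in round 1 and within \<open>g\<close> in round 3. All
  tails bound counts from above and are multiplied out to stay in the naturals. \<open>c\<close>
  bounds the pairs requested per round.\<close>

locale good_sample =
  fixes n q w1 w g c :: nat and \<pi> \<omega> :: "nat \<Rightarrow> nat"
  assumes \<pi>: "\<pi> permutes {1..n}"
    and q: "1 \<le> q"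
    and \<omega>: "j < q ^ 12 \<Longrightarrow> \<omega> j \<in> {1..n}"
    and w1: "2 * (n * q ^ 7) \<le> q ^ 12 * w1" "w1 \<le> n div 2"
    and tail1: "n * card {j. j < q ^ 12 \<and> n div 2 < \<pi> (\<omega> j)} + q ^ 12 * (n div 2) <
      q ^ 12 * n + n * q ^ 7"
    and tail2: "n * card {j. j < q ^ 12 \<and> \<pi> (\<omega> j) \<le> n div 2} < q ^ 12 * (n div 2) + n * q ^ 7"
    and tail3: "n * card {j. j < q ^ 12 \<and> \<pi> (\<omega> j) \<le> n div 2 - w1} + q ^ 12 * w1 <
      q ^ 12 * (n div 2) + n * q ^ 7"
    and tail4: "n * card {j. j < q ^ 12 \<and> n div 2 + w1 < \<pi> (\<omega> j)} + q ^ 12 * (n div 2 + w1) <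
      q ^ 12 * n + n * q ^ 7"
    and hit1: "\<exists>j<q ^ 6. n div 2 - w < \<pi> (\<omega> j) \<and> \<pi> (\<omega> j) \<le> n div 2 - w1"
    and hit2: "\<exists>j<q ^ 6. n div 2 + w1 < \<pi> (\<omega> j) \<and> \<pi> (\<omega> j) \<le> n div 2 + w"
    and hit3: "\<exists>j<q ^ 10. n div 2 - g < \<pi> (\<omega> j) \<and> \<pi> (\<omega> j) \<le> n div 2"
    and hit4: "\<exists>j<q ^ 10. n div 2 < \<pi> (\<omega> j) \<and> \<pi> (\<omega> j) \<le> n div 2 + g"
    and few: "card {j. j < q ^ 10 \<and> n div 2 - w < \<pi> (\<omega> j) \<and> \<pi> (\<omega> j) \<le> n div 2 + w} \<le> 25 * q ^ 5"
    and budget: "q ^ 18 \<le> c" "2 * n \<le> c" "2 * w * (25 * q ^ 5 + 2) \<le> c" "(2 * g) * (2 * g) \<le> c"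
begin

abbreviation "m \<equiv> n div 2"
abbreviation "u \<equiv> q ^ 12"
abbreviation "Lt \<equiv> less_pairs n \<pi>"

lemma pow_le: "q ^ 6 \<le> u" "q ^ 10 \<le> u"
  using q by (auto intro: power_increasing)

lemma sample_range: "\<omega> ` {..<q ^ 6} \<subseteq> {1..n}" "\<omega> ` {..<q ^ 10} \<subseteq> {1..n}" "\<omega> ` {..<u} \<subseteq> {1..n}"
  using \<omega> pow_le by (force simp del: atLeastAtMost_iff)+

lemma rank_eq: "x \<in> {1..n} \<Longrightarrow> y \<in> {1..n} \<Longrightarrow> \<pi> x = \<pi> y \<Longrightarrow> x = y"
  using permutes_inj[OF \<pi>] by (auto simp: inj_def)

lemma below_count_Lt:
  assumes "a \<in> {1..n}"
  shows "below_count q \<omega> Lt a = card {j. j < u \<and> \<pi> (\<omega> j) < \<pi> a}"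
  unfolding below_count_def using assms \<omega> by (intro arg_cong[of _ _ card]) (auto simp: less_pairs_def)

lemma card_compl: "card {j. j < u \<and> \<pi> (\<omega> j) \<le> r} + card {j. j < u \<and> r < \<pi> (\<omega> j)} = u"
proof -
  have "card {j. j < u \<and> \<pi> (\<omega> j) \<le> r} + card {j. j < u \<and> r < \<pi> (\<omega> j)} =
      card ({j. j < u \<and> \<pi> (\<omega> j) \<le> r} \<union> {j. j < u \<and> r < \<pi> (\<omega> j)})"
    by (rule card_Un_disjoint[symmetric]) auto
  also have "{j. j < u \<and> \<pi> (\<omega> j) \<le> r} \<union> {j. j < u \<and> r < \<pi> (\<omega> j)} = {..<u}" by auto
  finally show ?thesis by simp
qed

text \<open>Only upper tails are controlled, so a lower bound on the count is expressed through the
  number of samples above \<open>r\<close>.\<close>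

lemma below_count_ge:
  assumes "a \<in> {1..n}" "r < \<pi> a"
  shows "u \<le> below_count q \<omega> Lt a + card {j. j < u \<and> r < \<pi> (\<omega> j)}"
proof -
  have "card {j. j < u \<and> \<pi> (\<omega> j) \<le> r} \<le> below_count q \<omega> Lt a"
    unfolding below_count_Lt[OF assms(1)] using assms(2) by (intro card_mono) auto
  then show ?thesis using card_compl[of r] by linarith
qed

lemma below_count_le:
  assumes "a \<in> {1..n}" "\<pi> a \<le> r"
  shows "below_count q \<omega> Lt a \<le> card {j. j < u \<and> \<pi> (\<omega> j) \<le> r}"
  unfolding below_count_Lt[OF assms(1)] using assms(2) by (intro card_mono) auto

section \<open>The two pivots enclosing the median\<close>

abbreviation "low \<equiv> low_pivots n q \<omega> Lt"
abbreviation "high \<equiv> high_pivots n q \<omega> Lt"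

lemma low_subset: "low \<subseteq> {1..n}" and high_subset: "high \<subseteq> {1..n}"
  using sample_range(1) by (auto simp: low_pivots_def high_pivots_def)

text \<open>A pivot above the median has all samples of rank at most \<open>m\<close> below it, and
  by \<open>tail1\<close> these are too many for the test in \<open>low_pivots\<close>.\<close>

lemma low_rank:
  assumes "a \<in> low"
  shows "\<pi> a \<le> m"
proof (rule ccontr)
  assume "\<not> \<pi> a \<le> m"
  then have "u \<le> below_count q \<omega> Lt a + card {j. j < u \<and> m < \<pi> (\<omega> j)}"
    using assms low_subset by (intro below_count_ge) auto
  then have "n * u \<le> n * (below_count q \<omega> Lt a + card {j. j < u \<and> m < \<pi> (\<omega> j)})"
    by (rule mult_le_mono2)
  moreover have "n * below_count q \<omega> Lt a + n * q ^ 7 \<le> u * m"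
    using assms by (simp add: low_pivots_def)
  ultimately show False using tail1 by (simp add: distrib_left mult.commute[of n u])
qed

lemma high_rank:
  assumes "b \<in> high"
  shows "m < \<pi> b"
proof (rule ccontr)
  assume "\<not> m < \<pi> b"
  then have "below_count q \<omega> Lt b \<le> card {j. j < u \<and> \<pi> (\<omega> j) \<le> m}"
    using assms high_subset by (intro below_count_le) auto
  then have "n * below_count q \<omega> Lt b \<le> n * card {j. j < u \<and> \<pi> (\<omega> j) \<le> m}"
    by (rule mult_le_mono2)
  moreover have "u * m + n * q ^ 7 \<le> n * below_count q \<omega> Lt b"
    using assms by (simp add: high_pivots_def)
  ultimately show False using tail2 by linarith
qed

text \<open>The pivot of \<open>hit1\<close> passes the test: a distance of \<open>w1\<close> ranks
  lowers the expected count by at least \<open>2 * q ^ 7\<close>, one margin for the deviation and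
  one for the threshold.\<close>

lemma ex_low: "\<exists>a\<in>low. m - w < \<pi> a"
proof -
  obtain j where j: "j < q ^ 6" "m - w < \<pi> (\<omega> j)" "\<pi> (\<omega> j) \<le> m - w1" using hit1 by auto
  have "below_count q \<omega> Lt (\<omega> j) \<le> card {j. j < u \<and> \<pi> (\<omega> j) \<le> m - w1}"
    using j \<omega>[of j] pow_le by (intro below_count_le) auto
  then have "n * below_count q \<omega> Lt (\<omega> j) \<le> n * card {j. j < u \<and> \<pi> (\<omega> j) \<le> m - w1}"
    by (rule mult_le_mono2)
  then have "n * below_count q \<omega> Lt (\<omega> j) + n * q ^ 7 \<le> u * m"
    using tail3 w1 by linarith
  then show ?thesis using j by (intro bexI[of _ "\<omega> j"]) (auto simp: low_pivots_def)
qed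

lemma ex_high: "\<exists>b\<in>high. \<pi> b \<le> m + w"
proof -
  obtain j where j: "j < q ^ 6" "m + w1 < \<pi> (\<omega> j)" "\<pi> (\<omega> j) \<le> m + w" using hit2 by auto
  have "u \<le> below_count q \<omega> Lt (\<omega> j) + card {j. j < u \<and> m + w1 < \<pi> (\<omega> j)}"
    using j \<omega>[of j] pow_le by (intro below_count_ge) auto
  then have "n * u \<le> n * (below_count q \<omega> Lt (\<omega> j) + card {j. j < u \<and> m + w1 < \<pi> (\<omega> j)})"
    by (rule mult_le_mono2)
  then have "u * m + n * q ^ 7 \<le> n * below_count q \<omega> Lt (\<omega> j)"
    using tail4 w1 by (simp add: distrib_left mult.commute[of n u])
  then show ?thesis using j by (intro bexI[of _ "\<omega> j"]) (auto simp: high_pivots_def)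
qed

text \<open>The end is the highest-ranked element of \<open>low\<close>, unique because ranks are
  distinct. It is at most \<open>m\<close> by \<open>low_rank\<close> and no lower than the pivot of
  \<open>ex_low\<close>.\<close>

lemma lower_end_Lt:
  obtains a where "lower_end n q \<omega> Lt = {a}" "a \<in> {1..n}" "m - w < \<pi> a" "\<pi> a \<le> m"
proof -
  obtain a0 where a0: "a0 \<in> low" "m - w < \<pi> a0" using ex_low by auto
  have fin: "finite low" using low_subset finite_subset by blast
  then have "Max (\<pi> ` low) \<in> \<pi> ` low" using a0(1) by (intro Max_in) auto
  then obtain a where a: "a \<in> low" "\<pi> a = Max (\<pi> ` low)" by auto
  have max: "\<pi> x \<le> \<pi> a" if "x \<in> low" for x
    unfolding a(2) using fin that by simp
  have "lower_end n q \<omega> Lt = {x \<in> low. \<forall>p\<in>low. \<pi> p \<le> \<pi> x}"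
    unfolding lower_end_def using low_subset by (subst enclosed_less_pairs) auto
  also have "\<dots> = {a}"
  proof (rule set_eqI, rule iffI)
    fix x assume "x \<in> {x \<in> low. \<forall>p\<in>low. \<pi> p \<le> \<pi> x}"
    then have "x \<in> low" "\<pi> x = \<pi> a" using a(1) max by (auto intro: antisym)
    then show "x \<in> {a}" using rank_eq[of x a] a(1) low_subset by blast
  qed (use a(1) max in auto)
  finally show ?thesis
    using that[of a] a(1) low_subset low_rank[of a] a0(2) max[OF a0(1)] by auto
qed

lemma upper_end_Lt:
  obtains b where "upper_end n q \<omega> Lt = {b}" "b \<in> {1..n}" "m < \<pi> b" "\<pi> b \<le> m + w"
proof -
  obtain b0 where b0: "b0 \<in> high" "\<pi> b0 \<le> m + w" using ex_high by auto
  have fin: "finite high" using high_subset finite_subset by blast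
  then have "Min (\<pi> ` high) \<in> \<pi> ` high" using b0(1) by (intro Min_in) auto
  then obtain b where b: "b \<in> high" "\<pi> b = Min (\<pi> ` high)" by auto
  have min: "\<pi> b \<le> \<pi> x" if "x \<in> high" for x
    unfolding b(2) using fin that by simp
  have "upper_end n q \<omega> Lt = {x \<in> high. \<forall>p\<in>high. \<pi> x \<le> \<pi> p}"
    unfolding upper_end_def using high_subset by (subst enclosed_less_pairs) auto
  also have "\<dots> = {b}"
  proof (rule set_eqI, rule iffI)
    fix x assume "x \<in> {x \<in> high. \<forall>p\<in>high. \<pi> x \<le> \<pi> p}"
    then have "x \<in> high" "\<pi> x = \<pi> b" using b(1) min by (auto intro: antisym)
    then show "x \<in> {b}" using rank_eq[of x b] b(1) high_subset by blast
  qed (use b(1) min in auto)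
  finally show ?thesis
    using that[of b] b(1) high_subset high_rank[of b] b0(2) min[OF b0(1)] by auto
qed

definition "a = the_elem (lower_end n q \<omega> Lt)"
definition "b = the_elem (upper_end n q \<omega> Lt)"

lemma a: "lower_end n q \<omega> Lt = {a}" "a \<in> {1..n}" "m - w < \<pi> a" "\<pi> a \<le> m"
  by (rule lower_end_Lt, simp add: a_def)+

lemma b: "upper_end n q \<omega> Lt = {b}" "b \<in> {1..n}" "m < \<pi> b" "\<pi> b \<le> m + w"
  by (rule upper_end_Lt, simp add: b_def)+

section \<open>Window, pivots and core under the full order\<close>

abbreviation "M \<equiv> middle n q \<omega> Lt"
abbreviation "P \<equiv> middle_pivots n q \<omega> Lt"
abbreviation "Q \<equiv> core n q \<omega> Lt"

lemma middle_eq: "M = {x \<in> {1..n}. \<pi> a \<le> \<pi> x \<and> \<pi> x \<le> \<pi> b}"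
  unfolding middle_def a(1) b(1) using a(2) b(2) by (subst enclosed_less_pairs) auto

lemma middle_pivots_eq: "P = (\<omega> ` {..<q ^ 10} \<union> {a, b}) \<inter> M"
  unfolding middle_pivots_def a(1) b(1) by auto

lemma pivots_a_b: "a \<in> P" "b \<in> P"
  using a b by (auto simp: middle_pivots_eq middle_eq)

lemma middle_subset: "M \<subseteq> {1..n}" and pivots_subset: "P \<subseteq> {1..n}"
  by (auto simp: middle_pivots_eq middle_eq)

lemma core_eq: "Q = {x \<in> M. \<forall>p\<in>P. (\<pi> p \<le> m \<longrightarrow> \<pi> p \<le> \<pi> x) \<and> (m < \<pi> p \<longrightarrow> \<pi> x \<le> \<pi> p)}"
proof -
  have r: "known_rank Lt p = \<pi> p" if "p \<in> P" for p
    using known_rank_less_pairs[OF \<pi>] pivots_subset that by blast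
  have "{p \<in> P. known_rank Lt p \<le> m} = {p \<in> P. \<pi> p \<le> m}"
    "{p \<in> P. m < known_rank Lt p} = {p \<in> P. m < \<pi> p}"
    using r by auto
  then show ?thesis
    unfolding core_def using middle_subset pivots_subset by (subst enclosed_less_pairs) auto
qed

lemma card_middle: "card M \<le> 2 * w"
proof -
  have "card M \<le> card {x \<in> {1..n}. m - w < \<pi> x \<and> \<pi> x \<le> m + w}"
    using a b by (intro card_mono) (auto simp: middle_eq)
  also have "\<dots> \<le> m + w - (m - w)" by (rule card_rank_between[OF \<pi>])
  finally show ?thesis by linarith
qed

lemma card_pivots: "card P \<le> 25 * q ^ 5 + 2"
proof -
  let ?J = "{j. j < q ^ 10 \<and> m - w < \<pi> (\<omega> j) \<and> \<pi> (\<omega> j) \<le> m + w}"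
  have "card P \<le> card (\<omega> ` ?J \<union> {a, b})"
    using a b by (intro card_mono) (auto simp: middle_pivots_eq middle_eq)
  also have "\<dots> \<le> card (\<omega> ` ?J) + card {a, b}" by (rule card_Un_le)
  also have "\<dots> \<le> card ?J + 2" by (intro add_mono card_image_le) (auto simp: card_insert_if)
  finally show ?thesis using few by linarith
qed

text \<open>If the sample of \<open>hit3\<close> lies below \<open>a\<close>, it is outside the
  window, but then \<open>a\<close> itself is a pivot within \<open>g\<close> of the median. The
  same holds for \<open>hit4\<close> and \<open>b\<close>.\<close>

lemma core_rank:
  assumes "x \<in> Q"
  shows "m - g < \<pi> x" "\<pi> x \<le> m + g"
proof -
  obtain j where j: "j < q ^ 10" "m - g < \<pi> (\<omega> j)" "\<pi> (\<omega> j) \<le> m" using hit3 by auto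
  have "\<omega> j \<in> {1..n}" using j sample_range(2) by auto
  then have "\<pi> a \<le> \<pi> (\<omega> j) \<Longrightarrow> \<omega> j \<in> P"
    using j b(3) by (simp add: middle_eq middle_pivots_eq)
  then obtain p where p: "p \<in> P" "m - g < \<pi> p" "\<pi> p \<le> m"
    using j pivots_a_b(1) a(4) by (metis less_le_trans nle_le)
  have "\<pi> p \<le> \<pi> x" using assms p by (simp add: core_eq)
  then show "m - g < \<pi> x" using p(2) by linarith
  obtain j where j: "j < q ^ 10" "m < \<pi> (\<omega> j)" "\<pi> (\<omega> j) \<le> m + g" using hit4 by auto
  have "\<omega> j \<in> {1..n}" using j sample_range(2) by auto
  then have "\<pi> (\<omega> j) \<le> \<pi> b \<Longrightarrow> \<omega> j \<in> P"
    using j a(4) by (simp add: middle_eq middle_pivots_eq)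
  then obtain p where p: "p \<in> P" "m < \<pi> p" "\<pi> p \<le> m + g"
    using j pivots_a_b(2) b(3) by (metis le_trans nle_le)
  have "\<pi> x \<le> \<pi> p" using assms p by (simp add: core_eq)
  then show "\<pi> x \<le> m + g" using p(3) by linarith
qed

lemma card_core: "card Q \<le> 2 * g"
proof -
  have "card Q \<le> card {x \<in> {1..n}. m - g < \<pi> x \<and> \<pi> x \<le> m + g}"
    using core_rank middle_subset by (intro card_mono) (auto simp: core_eq)
  also have "\<dots> \<le> m + g - (m - g)" by (rule card_rank_between[OF \<pi>])
  finally show ?thesis by linarith
qed

section \<open>Computing the same sets from partial knowledge\<close>

lemma
  assumes "resolved n \<pi> (\<omega> ` {..<q ^ 6} \<times> \<omega> ` {..<u}) K"
  shows lower_end_resolved: "lower_end n q \<omega> K = {a}"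
    and upper_end_resolved: "upper_end n q \<omega> K = {b}"
proof -
  \<comment> \<open>Round 1 settles the counts of the first \<open>q ^ 6\<close> samples and, as
    these are among the \<open>q ^ 12\<close>, also their mutual order.\<close>
  have "(\<omega> j, x) \<in> K \<longleftrightarrow> (\<omega> j, x) \<in> Lt" if "j < u" "x \<in> \<omega> ` {..<q ^ 6}" for j x
    by (rule resolved_iff[OF assms]) (use that in auto)
  then have "below_count q \<omega> K x = below_count q \<omega> Lt x" if "x \<in> \<omega> ` {..<q ^ 6}" for x
    unfolding below_count_def using that by (intro arg_cong[of _ _ card]) auto
  then have eq: "low_pivots n q \<omega> K = low" "high_pivots n q \<omega> K = high"
    by (auto simp: low_pivots_def high_pivots_def)
  have sub: "low \<subseteq> \<omega> ` {..<q ^ 6}" "high \<subseteq> \<omega> ` {..<q ^ 6}" "\<omega> ` {..<q ^ 6} \<subseteq> \<omega> ` {..<u}"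
    using pow_le by (auto simp: low_pivots_def high_pivots_def intro!: imageI)
  have "lower_end n q \<omega> K = lower_end n q \<omega> Lt"
    unfolding lower_end_def eq by (rule enclosed_resolved[OF assms]) (use sub in blast)
  then show "lower_end n q \<omega> K = {a}" by (simp add: a)
  have "upper_end n q \<omega> K = upper_end n q \<omega> Lt"
    unfolding upper_end_def eq by (rule enclosed_resolved[OF assms]) (use sub in blast)
  then show "upper_end n q \<omega> K = {b}" by (simp add: b)
qed

lemma
  assumes "resolved n \<pi> (\<omega> ` {..<q ^ 6} \<times> \<omega> ` {..<u}) K" "resolved n \<pi> ({1..n} \<times> {a, b}) K"
  shows middle_resolved: "middle n q \<omega> K = M"
    and middle_pivots_resolved: "middle_pivots n q \<omega> K = P"
proof -
  note ends = lower_end_resolved[OF assms(1)] upper_end_resolved[OF assms(1)]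
  have "enclosed {1..n} {a} {b} K = enclosed {1..n} {a} {b} Lt"
    by (rule enclosed_resolved[OF assms(2)]) auto
  then show *: "middle n q \<omega> K = M" unfolding middle_def ends a(1) b(1) .
  show "middle_pivots n q \<omega> K = P" unfolding middle_pivots_def * ends a(1) b(1) ..
qed

text \<open>Elements outside \<open>M\<close> are connected to a pivot through \<open>a\<close> or \<open>b\<close>.\<close>

lemma pivot_connected:
  assumes "resolved n \<pi> ({1..n} \<times> {a, b}) K" "resolved n \<pi> (M \<times> P) K" "p \<in> P"
  shows "(y, p) \<in> Lt \<Longrightarrow> (y, p) \<in> K\<^sup>+" and "(p, y) \<in> Lt \<Longrightarrow> (p, y) \<in> K\<^sup>+"
proof -
  have "p \<in> M" using assms(3) by (simp add: middle_pivots_eq)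
  then have p: "p \<in> {1..n}" "\<pi> a \<le> \<pi> p" "\<pi> p \<le> \<pi> b" by (simp_all add: middle_eq)
  have ab: "(x, y) \<in> K" if "(x, y) \<in> Lt" "x \<in> {a, b} \<or> y \<in> {a, b}" for x y
  proof -
    have "x \<in> {1..n}" "y \<in> {1..n}" using that(1) by (auto simp: less_pairs_def)
    then have "(x, y) \<in> {1..n} \<times> {a, b} \<or> (y, x) \<in> {1..n} \<times> {a, b}" using that(2) by auto
    then show ?thesis using that(1) resolved_iff[OF assms(1)] by blast
  qed
  have direct: "(x, y) \<in> K" if "(x, y) \<in> Lt" "x \<in> M \<and> y \<in> P \<or> y \<in> M \<and> x \<in> P" for x y
    using that resolved_iff[OF assms(2), of x y] by blast
  \<comment> \<open>A path through an end \<open>e\<close>; the case \<open>e = z\<close> is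
    separate because \<open>(e, z)\<close> is then not a strict pair.\<close>
  have path: "(x, z) \<in> K\<^sup>+"
    if "(x, e) \<in> Lt" "e \<in> {a, b}" "\<pi> e \<le> \<pi> z" "z \<in> {1..n}" for x e z
  proof (cases "\<pi> e = \<pi> z")
    case True
    have "e \<in> {1..n}" using that(2) a(2) b(2) by blast
    then have "e = z" using that(4) True by (rule rank_eq)
    moreover have "(x, e) \<in> K" using that(1,2) by (intro ab disjI2)
    ultimately show ?thesis by blast
  next
    case False
    have "e \<in> {1..n}" using that(2) a(2) b(2) by blast
    then have "(e, z) \<in> Lt" using that(3,4) False by (simp add: less_pairs_def)
    then have "(e, z) \<in> K" using that(2) by (intro ab disjI1)
    moreover have "(x, e) \<in> K" using that(1,2) by (intro ab disjI2)
    ultimately show ?thesis by (meson r_into_trancl trancl_into_trancl)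
  qed
  have path': "(x, z) \<in> K\<^sup>+"
    if "(e, z) \<in> Lt" "e \<in> {a, b}" "\<pi> x \<le> \<pi> e" "x \<in> {1..n}" for x e z
  proof (cases "\<pi> x = \<pi> e")
    case True
    have "e \<in> {1..n}" using that(2) a(2) b(2) by blast
    with that(4) have "x = e" using True by (rule rank_eq)
    moreover have "(e, z) \<in> K" using that(1,2) by (intro ab disjI1)
    ultimately show ?thesis by blast
  next
    case False
    have "e \<in> {1..n}" using that(2) a(2) b(2) by blast
    then have "(x, e) \<in> Lt" using that(3,4) False by (simp add: less_pairs_def)
    then have "(x, e) \<in> K" using that(2) by (intro ab disjI2)
    moreover have "(e, z) \<in> K" using that(1,2) by (intro ab disjI1)
    ultimately show ?thesis by (meson r_into_trancl trancl_into_trancl)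
  qed
  show "(y, p) \<in> K\<^sup>+" if "(y, p) \<in> Lt"
  proof (cases "y \<in> M")
    case True
    then show ?thesis using direct that assms(3) by blast
  next
    case False
    moreover have y: "y \<in> {1..n}" "\<pi> y < \<pi> p" using that by (auto simp: less_pairs_def)
    \<comment> \<open>Being below \<open>p\<close>, hence below \<open>b\<close>, the element can
      leave the window only below \<open>a\<close>.\<close>
    ultimately have "\<pi> y < \<pi> a" using p(3) by (auto simp: middle_eq)
    then have "(y, a) \<in> Lt" using y(1) a(2) by (simp add: less_pairs_def)
    then show ?thesis using p by (intro path[of y a p]) auto
  qed
  show "(p, y) \<in> K\<^sup>+" if "(p, y) \<in> Lt"
  proof (cases "y \<in> M")
    case True
    then show ?thesis using direct that assms(3) by blast
  next
    case False
    moreover have y: "y \<in> {1..n}" "\<pi> p < \<pi> y" using that by (auto simp: less_pairs_def)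
    ultimately have "\<pi> b < \<pi> y" using p(2) by (auto simp: middle_eq)
    then have "(b, y) \<in> Lt" using y(1) b(2) by (simp add: less_pairs_def)
    then show ?thesis using p by (intro path'[of b y p]) auto
  qed
qed

text \<open>Although many pairs are still open, \<open>known_rank\<close> uses the transitive
  closure, and by \<open>pivot_connected\<close> every element below a pivot is connected to it. So
  pivot ranks are exact.\<close>

lemma core_resolved:
  assumes "resolved n \<pi> (\<omega> ` {..<q ^ 6} \<times> \<omega> ` {..<u}) K" "resolved n \<pi> ({1..n} \<times> {a, b}) K"
    "resolved n \<pi> (M \<times> P) K"
  shows "core n q \<omega> K = Q"
proof -
  have sub: "K \<subseteq> Lt" using assms(1) by (simp add: resolved_def)
  have "known_rank K p = known_rank Lt p" if "p \<in> P" for p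
  proof -
    have "{y. (y, p) \<in> K\<^sup>+} = {y. (y, p) \<in> Lt\<^sup>+}"
      using pivot_connected(1)[OF assms(2,3) that] trancl_mono[OF _ sub]
      by (auto simp: trancl_id[OF trans_less_pairs])
    then show ?thesis by (simp add: known_rank_def)
  qed
  then have "{p \<in> P. known_rank K p \<le> m} = {p \<in> P. known_rank Lt p \<le> m}"
    "{p \<in> P. m < known_rank K p} = {p \<in> P. m < known_rank Lt p}" by auto
  then show ?thesis
    unfolding core_def middle_resolved[OF assms(1,2)] middle_pivots_resolved[OF assms(1,2)]
    by (auto intro!: enclosed_resolved[OF assms(3)])
qed

text \<open>Either both elements were compared in the core, or one of them lies outside
  \<open>Q\<close>. In the latter case a pivot separates it from the median, hence lies strictly
  between \<open>y\<close> and \<open>x\<close> and connects them.\<close>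

lemma cut_connected:
  assumes "resolved n \<pi> ({1..n} \<times> {a, b}) K" "resolved n \<pi> (M \<times> P) K" "resolved n \<pi> (Q \<times> Q) K"
    and x: "x \<in> {1..n}" and y: "y \<in> {1..n}" and xy: "\<pi> y \<le> m" "m < \<pi> x"
  shows "(y, x) \<in> K\<^sup>+"
proof -
  have lt: "(y, x) \<in> Lt" using x y xy by (simp add: less_pairs_def)
  have via: "(y, x) \<in> K\<^sup>+" if "p \<in> P" "(y, p) \<in> Lt" "(p, x) \<in> Lt" for p
    using pivot_connected[OF assms(1,2) that(1)] that by (meson trancl_trans)
  consider "y \<in> Q" "x \<in> Q" | "y \<notin> Q" | "x \<notin> Q" by blast
  then show ?thesis
  proof cases
    case 1
    then show ?thesis using lt resolved_iff[OF assms(3), of y x] by blast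
  next
    case 2
    then have "\<exists>p\<in>P. \<pi> y < \<pi> p \<and> \<pi> p \<le> m"
      using xy y a b pivots_a_b by (force simp: core_eq middle_eq not_le)
    then obtain p where "p \<in> P" "\<pi> y < \<pi> p" "\<pi> p \<le> m" by blast
    then show ?thesis using pivots_subset x y xy by (intro via[of p]) (auto simp: less_pairs_def)
  next
    case 3
    then have "\<exists>p\<in>P. \<pi> p < \<pi> x \<and> m < \<pi> p"
      using xy x a b pivots_a_b by (force simp: core_eq middle_eq not_le)
    then obtain p where "p \<in> P" "\<pi> p < \<pi> x" "m < \<pi> p" by blast
    then show ?thesis using pivots_subset x y xy by (intro via[of p]) (auto simp: less_pairs_def)
  qed
qed

text \<open>Round by round, the pairs resolved so far make the next request the one computed from
  the full order; it fits the budget, so it is resolved as well. The factor \<open>2\<close> pays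
  for both directions.\<close>

lemma zero_error: "weighted_error n e \<pi> (run \<pi> (play n (2 * c) (strategies n q \<omega>) {})) = 0"
proof -
  define step where "step K S = K \<union> {(x, y) \<in> set (queries n (2 * c) S). \<pi> x < \<pi> y}" for K S
  let ?S1 = "\<omega> ` {..<q ^ 6} \<times> \<omega> ` {..<u}" and ?S2 = "{1..n} \<times> {a, b}"
  define K1 where "K1 = step {} ?S1"
  define K2 where "K2 = step K1 ?S2"
  define K3 where "K3 = step K2 (M \<times> P)"
  define K4 where "K4 = step K3 (Q \<times> Q)"
  have step: "resolved n \<pi> S (step K S)" if "K \<subseteq> Lt" "card S \<le> c" "finite S" for K S
    unfolding step_def by (rule resolved_step[OF that(1,2) _ that(3)]) simp
  have sub: "K \<subseteq> Lt" if "resolved n \<pi> S K" for K S using that by (simp add: resolved_def)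
  have incr: "K \<subseteq> step K S" for K S by (auto simp: step_def)
  note fin = finite_subset[OF middle_subset] finite_subset[OF pivots_subset]
  have "card (\<omega> ` {..<q ^ 6}) * card (\<omega> ` {..<u}) \<le> q ^ 6 * u"
    by (intro mult_le_mono) (metis card_image_le card_lessThan finite_lessThan)+
  also have "\<dots> = q ^ 18" by (simp flip: power_add)
  finally have r1: "resolved n \<pi> ?S1 K1"
    unfolding K1_def using budget(1) by (intro step) (auto simp: card_cartesian_product)
  have "n * card {a, b} \<le> n * 2" by (intro mult_le_mono2) (simp add: card_insert_if)
  then have "n * card {a, b} \<le> c" using budget(2) by linarith
  then have r2: "resolved n \<pi> ?S2 K2"
    unfolding K2_def using sub[OF r1] by (intro step) (auto simp: card_cartesian_product)
  have "card M * card P \<le> 2 * w * (25 * q ^ 5 + 2)"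
    by (intro mult_le_mono card_middle card_pivots)
  then have r3: "resolved n \<pi> (M \<times> P) K3"
    unfolding K3_def using budget(3) sub[OF r2] fin
    by (intro step) (auto simp: card_cartesian_product)
  have "Q \<subseteq> M" by (auto simp: core_eq)
  then have "finite Q" using fin finite_subset by blast
  moreover have "card Q * card Q \<le> (2 * g) * (2 * g)"
    by (intro mult_le_mono card_core)
  ultimately have r4: "resolved n \<pi> (Q \<times> Q) K4"
    unfolding K4_def using budget(4) sub[OF r3]
    by (intro step) (auto simp: card_cartesian_product)
  have K: "K1 \<subseteq> K2" "K2 \<subseteq> K3" "K3 \<subseteq> K4" unfolding K2_def K3_def K4_def by (rule incr)+
  \<comment> \<open>Knowledge only grows inside \<open>Lt\<close>, so earlier rounds stay
    resolved.\<close>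
  note s1 = resolved_mono[OF r1 K(1) sub[OF r2]]
  note s2 = resolved_mono[OF s1 K(2) sub[OF r3]]
  note t2 = resolved_mono[OF r2 K(2) sub[OF r3]]
  have ends: "{a} \<union> {b} = {a, b}" by auto
  have learn: "learn n (2 * c) \<pi> (strategies n q \<omega>) {} = K4"
    by (simp only: strategies_def learn.simps step_def[symmetric] K1_def[symmetric] K2_def[symmetric]
        K3_def[symmetric] K4_def[symmetric] ends
        lower_end_resolved[OF r1] upper_end_resolved[OF r1] middle_resolved[OF s1 r2]
        middle_pivots_resolved[OF s1 r2] core_resolved[OF s2 t2 r3])
  show ?thesis
  proof (rule weighted_error_play[OF \<pi>])
    show "learn n (2 * c) \<pi> (strategies n q \<omega>) {} \<subseteq> Lt"
      unfolding learn by (rule sub[OF r4])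
  next
    fix x y assume "x \<in> {1..n}" "y \<in> {1..n}" "\<pi> y \<le> m" "m < \<pi> x"
    then show "(y, x) \<in> (learn n (2 * c) \<pi> (strategies n q \<omega>) {})\<^sup>+"
      unfolding learn
      by (rule cut_connected[OF resolved_mono[OF t2 K(3) sub[OF r4]]
            resolved_mono[OF r3 K(3) sub[OF r4]] r4])
  qed
qed

end

section \<open>Probability of a bad sample\<close>

lemma length_strategies: "length (strategies n q \<omega>) = 4"
  by (simp add: strategies_def)

text \<open>Drawing with replacement gives exact independence; numbers of distinct labels are
  bounded by numbers of indices.\<close>

definition sample_pmf :: "nat \<Rightarrow> nat \<Rightarrow> (nat \<Rightarrow> nat) pmf" where
  "sample_pmf n q = Pi_pmf {..<q ^ 12} 1 (\<lambda>_. pmf_of_set {1..n})"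

lemma prob_rank_in:
  assumes "\<pi> permutes {1..n}" "1 \<le> n"
  shows "measure_pmf.prob (pmf_of_set {1..n}) {x. \<pi> x \<in> R} =
    real (card (R \<inter> {1..n})) / real n"
proof -
  have "{1..n} \<inter> {x. \<pi> x \<in> R} = {x \<in> {1..n}. \<pi> x \<in> R}" by auto
  then show ?thesis using assms(2) card_rank_in[OF assms(1), of R]
    by (subst measure_pmf_of_set) simp_all
qed

lemma prob_count_deviates:
  assumes \<pi>: "\<pi> permutes {1..n}" and n: "1 \<le> n" and q: "1 \<le> q"
  shows "measure_pmf.prob (sample_pmf n q)
      {\<omega>. q ^ 12 * card (R \<inter> {1..n}) + n * q ^ 7 \<le> n * card {j. j < q ^ 12 \<and> \<pi> (\<omega> j) \<in> R}}
    \<le> exp (- (real q / 4))"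
proof -
  define k where "k = card (R \<inter> {1..n})"
  \<comment> \<open>The minimiser of \<open>l\<^sup>2 * q ^ 12 - l * q ^ 7\<close>, with minimum
    \<open>- q\<^sup>2 / 4\<close>.\<close>
  let ?l = "1 / (2 * real q ^ 5)"
  let ?s = "real q ^ 12 * real k / real n + real q ^ 7"
  let ?J = "{..<q ^ 12}"
  have "card (R \<inter> {1..n}) \<le> card {1..n}" by (intro card_mono) auto
  then have k: "k \<le> n" by (simp add: k_def)
  have q5: "1 \<le> real q ^ 5" using q by simp
  have "{\<omega>. q ^ 12 * k + n * q ^ 7 \<le> n * card {j. j < q ^ 12 \<and> \<pi> (\<omega> j) \<in> R}}
      \<subseteq> {\<omega>. ?s \<le> real (card {j \<in> ?J. \<omega> j \<in> {x. \<pi> x \<in> R}})}"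
  proof clarify
    fix \<omega> assume "q ^ 12 * k + n * q ^ 7 \<le> n * card {j. j < q ^ 12 \<and> \<pi> (\<omega> j) \<in> R}"
    then have "real (q ^ 12 * k + n * q ^ 7) \<le> real (n * card {j. j < q ^ 12 \<and> \<pi> (\<omega> j) \<in> R})"
      by (rule of_nat_mono)
    then show "?s \<le> real (card {j \<in> ?J. \<omega> j \<in> {x. \<pi> x \<in> R}})"
      using n by (simp add: field_simps)
  qed
  then have "measure_pmf.prob (sample_pmf n q)
      {\<omega>. q ^ 12 * k + n * q ^ 7 \<le> n * card {j. j < q ^ 12 \<and> \<pi> (\<omega> j) \<in> R}} \<le>
    measure_pmf.prob (sample_pmf n q) {\<omega>. ?s \<le> real (card {j \<in> ?J. \<omega> j \<in> {x. \<pi> x \<in> R}})}"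
    by (intro measure_pmf.finite_measure_mono) auto
  also have "\<dots> \<le> exp (measure_pmf.prob (pmf_of_set {1..n}) {x. \<pi> x \<in> R} *
      (?l + ?l\<^sup>2) * real (card ?J) - ?l * ?s)"
    unfolding sample_pmf_def using q5 by (intro prob_sample_count_ge) (auto simp: divide_le_eq)
  also have "measure_pmf.prob (pmf_of_set {1..n}) {x. \<pi> x \<in> R} * (?l + ?l\<^sup>2) * real (card ?J) - ?l * ?s
      = real k / real n * (?l + ?l\<^sup>2) * real q ^ 12 - ?l * ?s"
    using prob_rank_in[OF \<pi> n, of R] by (simp add: k_def)
  \<comment> \<open>The part linear in \<open>?l\<close> is the mean and cancels against the first
    summand of \<open>?s\<close>.\<close>
  also have "\<dots> = real k / real n * (?l\<^sup>2 * real q ^ 12) - ?l * real q ^ 7"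
    by (simp add: algebra_simps)
  also have "?l\<^sup>2 * real q ^ 12 = (real q)\<^sup>2 / 4"
    using q by (simp add: field_simps power2_eq_square flip: power_add) (simp add: power_numeral_reduce)
  also have "?l * real q ^ 7 = (real q)\<^sup>2 / 2"
    using q by (simp add: field_simps power2_eq_square) (simp add: power_numeral_reduce)
  also have "exp (real k / real n * ((real q)\<^sup>2 / 4) - (real q)\<^sup>2 / 2) \<le> exp (- (real q / 4))"
  proof (subst exp_le_cancel_iff)
    have "real k / real n * ((real q)\<^sup>2 / 4) \<le> 1 * ((real q)\<^sup>2 / 4)"
      using k n by (intro mult_right_mono) auto
    moreover have "real q \<le> (real q)\<^sup>2" using q by (simp add: power2_eq_square)
    ultimately show "real k / real n * ((real q)\<^sup>2 / 4) - (real q)\<^sup>2 / 2 \<le> - (real q / 4)" by linarith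
  qed
  finally show ?thesis by (simp add: k_def)
qed

text \<open>The assumption on \<open>R\<close> says that at least \<open>q\<close> hits are
  expected, which gives \<open>exp (- q)\<close>; the weaker bound is uniform with the other
  events.\<close>

lemma prob_window_missed:
  assumes \<pi>: "\<pi> permutes {1..n}" and n: "1 \<le> n" and e: "e \<le> 12" and q: "1 \<le> q"
    and R: "q * n \<le> card (R \<inter> {1..n}) * q ^ e"
  shows "measure_pmf.prob (sample_pmf n q) {\<omega>. \<not> (\<exists>j<q ^ e. \<pi> (\<omega> j) \<in> R)} \<le> exp (- (real q / 4))"
proof -
  let ?J = "{..<q ^ e}"
  have "{\<omega>. \<not> (\<exists>j<q ^ e. \<pi> (\<omega> j) \<in> R)} = {\<omega>. \<forall>j\<in>?J. \<omega> j \<notin> {x. \<pi> x \<in> R}}" by auto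
  also have "measure_pmf.prob (sample_pmf n q) \<dots> \<le>
      exp (- (measure_pmf.prob (pmf_of_set {1..n}) {x. \<pi> x \<in> R} * real (card ?J)))"
    unfolding sample_pmf_def
    using power_increasing[OF e, of q] q by (intro prob_sample_misses) auto
  also have "\<dots> \<le> exp (- (real q / 4))"
  proof -
    have "real (q * n) \<le> real (card (R \<inter> {1..n}) * q ^ e)" using R by (rule of_nat_mono)
    then have "real q \<le> real (card (R \<inter> {1..n})) / real n * real q ^ e"
      using n by (simp add: field_simps)
    also have "\<dots> = measure_pmf.prob (pmf_of_set {1..n}) {x. \<pi> x \<in> R} * real (card ?J)"
      using prob_rank_in[OF \<pi> n, of R] by simp
    finally have "- (measure_pmf.prob (pmf_of_set {1..n}) {x. \<pi> x \<in> R} * real (card ?J)) \<le>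
        - (real q / 4)" by linarith
    then show ?thesis by (simp only: exp_le_cancel_iff)
  qed
  finally show ?thesis .
qed

text \<open>At most \<open>12 * q ^ 5\<close> hits are expected. The Chernoff bound with
  \<open>l = 1\<close> doubles this to \<open>24 * q ^ 5\<close>, so the threshold
  \<open>25 * q ^ 5\<close> leaves the exponent \<open>- q ^ 5\<close>.\<close>

lemma prob_window_crowded:
  assumes \<pi>: "\<pi> permutes {1..n}" and n: "1 \<le> n" and q: "1 \<le> q"
    and R: "card (R \<inter> {1..n}) * q ^ 10 \<le> 12 * n * q ^ 5"
  shows "measure_pmf.prob (sample_pmf n q) {\<omega>. \<not> card {j. j < q ^ 10 \<and> \<pi> (\<omega> j) \<in> R} \<le> 25 * q ^ 5}
    \<le> exp (- (real q / 4))"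
proof -
  let ?J = "{..<q ^ 10}"
  let ?p = "measure_pmf.prob (pmf_of_set {1..n}) {x. \<pi> x \<in> R}"
  have "measure_pmf.prob (sample_pmf n q) {\<omega>. \<not> card {j. j < q ^ 10 \<and> \<pi> (\<omega> j) \<in> R} \<le> 25 * q ^ 5} \<le>
      measure_pmf.prob (sample_pmf n q)
        {\<omega>. real (25 * q ^ 5) \<le> real (card {j \<in> ?J. \<omega> j \<in> {x. \<pi> x \<in> R}})}"
    by (intro measure_pmf.finite_measure_mono) (auto simp del: of_nat_mult of_nat_power)
  also have "\<dots> \<le> exp (?p * (1 + 1\<^sup>2) * real (card ?J) - 1 * real (25 * q ^ 5))"
    unfolding sample_pmf_def
    using power_increasing[of 10 12 q] q by (intro prob_sample_count_ge) auto
  also have "\<dots> \<le> exp (- (real q / 4))"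
  proof (subst exp_le_cancel_iff)
    have "real (card (R \<inter> {1..n}) * q ^ 10) \<le> real (12 * n * q ^ 5)" using R by (rule of_nat_mono)
    then have "?p * real q ^ 10 \<le> 12 * real q ^ 5"
      unfolding prob_rank_in[OF \<pi> n] using n by (simp add: field_simps)
    moreover have "real q \<le> real q ^ 5" using power_increasing[of 1 5 "real q"] q by simp
    moreover have "?p * (1 + 1\<^sup>2) * real (card ?J) - 1 * real (25 * q ^ 5) =
        2 * (?p * real q ^ 10) - 25 * real q ^ 5" by simp
    ultimately show "?p * (1 + 1\<^sup>2) * real (card ?J) - 1 * real (25 * q ^ 5) \<le> - (real q / 4)"
      using of_nat_0_le_iff[of q] by linarith
  qed
  finally show ?thesis .
qed

lemma prob_error_le:
  assumes \<pi>: "\<pi> permutes {1..n}" and q: "3 \<le> q" and n: "q ^ 18 \<le> n" "n < (2 * q) ^ 18"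
  shows "measure_pmf.prob (sample_pmf n q)
      {\<omega>. weighted_error n e \<pi> (run \<pi> (play n (2 ^ 23 * n) (strategies n q \<omega>) {})) \<noteq> 0}
    \<le> 9 * exp (- (real q / 4))"
proof -
  let ?\<Omega> = "sample_pmf n q"
  \<comment> \<open>The margin \<open>q ^ 7\<close> converted into ranks is
    \<open>n / q ^ 5\<close>, which \<open>h\<close> exceeds; thus \<open>w1 = 2 * h\<close> covers
    two margins. A window of \<open>h\<close> ranks expects at least \<open>q\<close> of the first
    \<open>q ^ 6\<close> samples.\<close>
  define h where "h = n div q ^ 5 + 1"
  \<comment> \<open>A gap of \<open>g\<close> ranks expects at least \<open>q\<close> of the first
    \<open>q ^ 10\<close> samples, and its square is still \<open>O(n)\<close>.\<close>
  define g where "g = n div q ^ 9 + 1"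
  define m where "m = n div 2"
  have q1: "1 \<le> q" and n1: "1 \<le> n" using q n(1) one_le_power[of q 18] by linarith+
  have q_le: "q ^ i \<le> n" if "i \<le> 18" for i
    using power_increasing[OF that q1] n(1) by linarith
  have h1: "n \<le> q ^ 5 * h" and h2: "q ^ 5 * h \<le> 2 * n"
    using dividend_less_times_div[of "q ^ 5" n] times_div_less_eq_dividend[of "q ^ 5" n] q_le[of 5] q1
    unfolding h_def distrib_left mult_1_right by (simp, linarith)
  have g1: "n \<le> q ^ 9 * g" and g2: "q ^ 9 * g \<le> 2 * n"
    using dividend_less_times_div[of "q ^ 9" n] times_div_less_eq_dividend[of "q ^ 9" n] q_le[of 9] q1
    unfolding g_def distrib_left mult_1_right by (simp, linarith)
  \<comment> \<open>Here \<open>243 = 3 ^ 5\<close>; this keeps \<open>m - 3 * h\<close> and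
    \<open>m + 3 * h\<close> between \<open>0\<close> and \<open>n\<close>.\<close>
  have "243 * h \<le> q ^ 5 * h" using power_mono[OF q, of 5] by (intro mult_le_mono1) simp
  then have h: "12 * h \<le> n" using h2 by linarith
  have gh: "g \<le> h"
    unfolding g_def h_def using q1 by (intro add_mono div_le_mono2 power_increasing) auto
  have wm: "3 * h \<le> m" "m + 3 * h \<le> n" using h by (auto simp: m_def)

  have c2: "card ({..r} \<inter> {1..n}) = r" if "r \<le> n" for r
  proof -
    have *: "{..r} \<inter> {1..n} = {1..r}" using that by auto
    show ?thesis unfolding * by simp
  qed
  have c3: "card ({r<..} \<inter> {1..n}) = n - r" for r
  proof -
    have *: "{r<..} \<inter> {1..n} = {r<..n}" by auto
    show ?thesis unfolding * by simp
  qed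
  have c4: "card ({r<..s} \<inter> {1..n}) = s - r" if "s \<le> n" for r s
  proof -
    have *: "{r<..s} \<inter> {1..n} = {r<..s}" using that by auto
    show ?thesis unfolding * by simp
  qed

  \<comment> \<open>Four tails, four missed windows and one crowded window, the ways in which
    \<open>good_sample\<close> can fail; their number is the factor \<open>9\<close>.\<close>
  define bad where "bad = [
    {\<omega>. q ^ 12 * card ({m<..} \<inter> {1..n}) + n * q ^ 7 \<le> n * card {j. j < q ^ 12 \<and> \<pi> (\<omega> j) \<in> {m<..}}},
    {\<omega>. q ^ 12 * card ({..m} \<inter> {1..n}) + n * q ^ 7 \<le> n * card {j. j < q ^ 12 \<and> \<pi> (\<omega> j) \<in> {..m}}},
    {\<omega>. q ^ 12 * card ({..m - 2 * h} \<inter> {1..n}) + n * q ^ 7 \<le>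
      n * card {j. j < q ^ 12 \<and> \<pi> (\<omega> j) \<in> {..m - 2 * h}}},
    {\<omega>. q ^ 12 * card ({m + 2 * h<..} \<inter> {1..n}) + n * q ^ 7 \<le>
      n * card {j. j < q ^ 12 \<and> \<pi> (\<omega> j) \<in> {m + 2 * h<..}}},
    {\<omega>. \<not> (\<exists>j<q ^ 6. \<pi> (\<omega> j) \<in> {m - 3 * h<..m - 2 * h})},
    {\<omega>. \<not> (\<exists>j<q ^ 6. \<pi> (\<omega> j) \<in> {m + 2 * h<..m + 3 * h})},
    {\<omega>. \<not> (\<exists>j<q ^ 10. \<pi> (\<omega> j) \<in> {m - g<..m})},
    {\<omega>. \<not> (\<exists>j<q ^ 10. \<pi> (\<omega> j) \<in> {m<..m + g})},
    {\<omega>. \<not> card {j. j < q ^ 10 \<and> \<pi> (\<omega> j) \<in> {m - 3 * h<..m + 3 * h}} \<le> 25 * q ^ 5}]"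

  have hit_h: "q * n \<le> h * q ^ 6" using mult_le_mono2[OF h1, of q] by (simp add: power_numeral_reduce ac_simps)
  have hit_g: "q * n \<le> g * q ^ 10" using mult_le_mono2[OF g1, of q] by (simp add: power_numeral_reduce ac_simps)
  have "measure_pmf.prob ?\<Omega> B \<le> exp (- (real q / 4))" if "B \<in> set bad" for B
  proof -
    have "q ^ 5 * (q ^ 5 * h) \<le> q ^ 5 * (2 * n)" using h2 by (rule mult_le_mono2)
    then have crowd: "6 * h * q ^ 10 \<le> 12 * n * q ^ 5" by (simp add: power_numeral_reduce ac_simps)
    have k: "card ({m - 3 * h<..m - 2 * h} \<inter> {1..n}) = h"
      "card ({m + 2 * h<..m + 3 * h} \<inter> {1..n}) = h"
      "card ({m - g<..m} \<inter> {1..n}) = g" "card ({m<..m + g} \<inter> {1..n}) = g"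
      "card ({m - 3 * h<..m + 3 * h} \<inter> {1..n}) = 6 * h"
      by (subst c4; use wm gh in arith)+
    note dev = prob_count_deviates[OF \<pi> n1 q1] and miss = prob_window_missed[OF \<pi> n1 _ q1]
      and crowded = prob_window_crowded[OF \<pi> n1 q1]
    have "measure_pmf.prob ?\<Omega> {\<omega>. \<not> (\<exists>j<q ^ 6. \<pi> (\<omega> j) \<in> {m - 3 * h<..m - 2 * h})} \<le> exp (- (real q / 4))"
      "measure_pmf.prob ?\<Omega> {\<omega>. \<not> (\<exists>j<q ^ 6. \<pi> (\<omega> j) \<in> {m + 2 * h<..m + 3 * h})} \<le> exp (- (real q / 4))"
      by (rule miss; simp only: k hit_h; simp)+
    moreover have "measure_pmf.prob ?\<Omega> {\<omega>. \<not> (\<exists>j<q ^ 10. \<pi> (\<omega> j) \<in> {m - g<..m})} \<le> exp (- (real q / 4))"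
      "measure_pmf.prob ?\<Omega> {\<omega>. \<not> (\<exists>j<q ^ 10. \<pi> (\<omega> j) \<in> {m<..m + g})} \<le> exp (- (real q / 4))"
      by (rule miss; simp only: k hit_g; simp)+
    moreover have "measure_pmf.prob ?\<Omega>
        {\<omega>. \<not> card {j. j < q ^ 10 \<and> \<pi> (\<omega> j) \<in> {m - 3 * h<..m + 3 * h}} \<le> 25 * q ^ 5} \<le> exp (- (real q / 4))"
      by (rule crowded) (simp only: k crowd)
    ultimately show ?thesis using that dev by (auto simp only: bad_def set_simps)
  qed
  then have "(\<Sum>B\<leftarrow>bad. measure_pmf.prob ?\<Omega> B) \<le> (\<Sum>B\<leftarrow>bad. exp (- (real q / 4)))"
    by (rule sum_list_mono)
  also have "\<dots> = 9 * exp (- (real q / 4))" by (simp add: bad_def)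
  finally have sum: "(\<Sum>B\<leftarrow>bad. measure_pmf.prob ?\<Omega> B) \<le> 9 * exp (- (real q / 4))" .
  have union: "measure_pmf.prob ?\<Omega> (\<Union> (set Bs)) \<le> (\<Sum>B\<leftarrow>Bs. measure_pmf.prob ?\<Omega> B)" for Bs
  proof (induction Bs)
    case (Cons B Bs)
    have "measure_pmf.prob ?\<Omega> (B \<union> \<Union> (set Bs)) \<le>
        measure_pmf.prob ?\<Omega> B + measure_pmf.prob ?\<Omega> (\<Union> (set Bs))"
      by (rule measure_subadditive) auto
    then show ?case using Cons by simp
  qed simp

  have zero: "weighted_error n e \<pi> (run \<pi> (play n (2 ^ 23 * n) (strategies n q \<omega>) {})) = 0"
    if "\<omega> \<in> set_pmf ?\<Omega>" "\<omega> \<notin> \<Union> (set bad)" for \<omega>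
  proof -
    have good: "good_sample n q (2 * h) (3 * h) g (2 ^ 22 * n) \<pi> \<omega>"
    proof (unfold_locales, fold m_def)
      show "\<pi> permutes {1..n}" "1 \<le> q" by fact+
      show "\<omega> j \<in> {1..n}" if "j < q ^ 12" for j
      proof -
        have "\<omega> \<in> PiE_dflt {..<q ^ 12} 1 (\<lambda>_. set_pmf (pmf_of_set {1..n}))"
          using \<open>\<omega> \<in> set_pmf ?\<Omega>\<close> by (simp add: sample_pmf_def set_Pi_pmf)
        then show ?thesis using that n1 by (auto simp: PiE_dflt_def)
      qed
      have "q ^ 7 * n \<le> q ^ 7 * (q ^ 5 * h)" using h1 by (rule mult_le_mono2)
      then show "2 * (n * q ^ 7) \<le> q ^ 12 * (2 * h)" by (simp add: power_numeral_reduce ac_simps)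
      show "2 * h \<le> m" using wm by simp
      have mn: "m \<le> n" and mn': "m - 2 * h \<le> n" by (auto simp: m_def)
      have s: "q ^ 12 * (n - r) + q ^ 12 * r = q ^ 12 * n" if "r \<le> n" for r
        using that by (simp flip: distrib_left)
      have s': "q ^ 12 * (m - r) + q ^ 12 * r = q ^ 12 * m" if "r \<le> m" for r
        using that by (simp flip: distrib_left)
      have t: "\<not> q ^ 12 * card ({m<..} \<inter> {1..n}) + n * q ^ 7 \<le> n * card {j. j < q ^ 12 \<and> \<pi> (\<omega> j) \<in> {m<..}}"
        "\<not> q ^ 12 * card ({..m} \<inter> {1..n}) + n * q ^ 7 \<le> n * card {j. j < q ^ 12 \<and> \<pi> (\<omega> j) \<in> {..m}}"
        "\<not> q ^ 12 * card ({..m - 2 * h} \<inter> {1..n}) + n * q ^ 7 \<le>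
          n * card {j. j < q ^ 12 \<and> \<pi> (\<omega> j) \<in> {..m - 2 * h}}"
        "\<not> q ^ 12 * card ({m + 2 * h<..} \<inter> {1..n}) + n * q ^ 7 \<le>
          n * card {j. j < q ^ 12 \<and> \<pi> (\<omega> j) \<in> {m + 2 * h<..}}"
        using that(2) unfolding bad_def by (simp_all only: set_simps Union_insert Un_iff mem_Collect_eq de_Morgan_disj simp_thms)
      show "n * card {j. j < q ^ 12 \<and> m < \<pi> (\<omega> j)} + q ^ 12 * m < q ^ 12 * n + n * q ^ 7"
        using t(1)[unfolded c3 greaterThan_iff] s[of m] wm(2) by linarith
      show "n * card {j. j < q ^ 12 \<and> \<pi> (\<omega> j) \<le> m} < q ^ 12 * m + n * q ^ 7"
        using t(2)[unfolded c2[OF mn] atMost_iff] by linarith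
      show "n * card {j. j < q ^ 12 \<and> \<pi> (\<omega> j) \<le> m - 2 * h} + q ^ 12 * (2 * h) < q ^ 12 * m + n * q ^ 7"
        using t(3)[unfolded c2[OF mn'] atMost_iff] s'[of "2 * h"] wm(1) by linarith
      show "n * card {j. j < q ^ 12 \<and> m + 2 * h < \<pi> (\<omega> j)} + q ^ 12 * (m + 2 * h) < q ^ 12 * n + n * q ^ 7"
        using t(4)[unfolded c3 greaterThan_iff] s[of "m + 2 * h"] wm(2) by linarith
      have "\<exists>j<q ^ 6. \<pi> (\<omega> j) \<in> {m - 3 * h<..m - 2 * h}" "\<exists>j<q ^ 6. \<pi> (\<omega> j) \<in> {m + 2 * h<..m + 3 * h}"
        "\<exists>j<q ^ 10. \<pi> (\<omega> j) \<in> {m - g<..m}" "\<exists>j<q ^ 10. \<pi> (\<omega> j) \<in> {m<..m + g}"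
        "card {j. j < q ^ 10 \<and> \<pi> (\<omega> j) \<in> {m - 3 * h<..m + 3 * h}} \<le> 25 * q ^ 5"
        using that(2) unfolding bad_def
        by (simp_all only: set_simps Union_insert Un_iff mem_Collect_eq de_Morgan_disj simp_thms not_not)
      then show "\<exists>j<q ^ 6. m - 3 * h < \<pi> (\<omega> j) \<and> \<pi> (\<omega> j) \<le> m - 2 * h"
        "\<exists>j<q ^ 6. m + 2 * h < \<pi> (\<omega> j) \<and> \<pi> (\<omega> j) \<le> m + 3 * h"
        "\<exists>j<q ^ 10. m - g < \<pi> (\<omega> j) \<and> \<pi> (\<omega> j) \<le> m"
        "\<exists>j<q ^ 10. m < \<pi> (\<omega> j) \<and> \<pi> (\<omega> j) \<le> m + g"
        "card {j. j < q ^ 10 \<and> m - 3 * h < \<pi> (\<omega> j) \<and> \<pi> (\<omega> j) \<le> m + 3 * h} \<le> 25 * q ^ 5"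
        by (simp_all only: greaterThanAtMost_iff)
      show "q ^ 18 \<le> 2 ^ 22 * n" "2 * n \<le> 2 ^ 22 * n" using n(1) by simp_all
      have "25 * q ^ 5 + 2 \<le> 27 * q ^ 5" using one_le_power[OF q1, of 5] by linarith
      then have "2 * (3 * h) * (25 * q ^ 5 + 2) \<le> 2 * (3 * h) * (27 * q ^ 5)"
        by (rule mult_le_mono2)
      also have "\<dots> = 162 * (q ^ 5 * h)" by simp
      also have "\<dots> \<le> 162 * (2 * n)" using h2 by (rule mult_le_mono2)
      finally show "2 * (3 * h) * (25 * q ^ 5 + 2) \<le> 2 ^ 22 * n" by simp
      \<comment> \<open>Round 4 dictates the budget: \<open>q ^ 9 * g \<le> 2 * n\<close> and
        \<open>n < (2 * q) ^ 18\<close> give \<open>g * g \<le> 2 ^ 20 * n\<close>, and the core has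
        up to \<open>2 * g\<close> elements.\<close>
      have "q ^ 18 * (g * g) = (q ^ 9 * g) * (q ^ 9 * g)"
        by (simp add: power_numeral_reduce ac_simps)
      also have "\<dots> \<le> (2 * n) * (2 * n)" by (rule mult_le_mono[OF g2 g2])
      also have "\<dots> \<le> (2 * n) * (2 * (2 * q) ^ 18)" using n(2) by (intro mult_le_mono2) simp
      also have "\<dots> = q ^ 18 * (2 ^ 20 * n)" by (simp add: power_mult_distrib)
      finally have "g * g \<le> 2 ^ 20 * n" using q1 by simp
      then show "2 * g * (2 * g) \<le> 2 ^ 22 * n" by simp
    qed
    show ?thesis using good_sample.zero_error[OF good] by (simp add: mult.assoc[symmetric])
  qed
  have "measure_pmf.prob ?\<Omega>
      {\<omega>. weighted_error n e \<pi> (run \<pi> (play n (2 ^ 23 * n) (strategies n q \<omega>) {})) \<noteq> 0} \<le>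
      measure_pmf.prob ?\<Omega> (\<Union> (set bad))"
    \<comment> \<open>The inclusion holds only on the support, where all sampled labels lie in
      \<open>{1..n}\<close>.\<close>
    by (rule measure_pmf.finite_measure_mono_AE) (auto intro!: AE_pmfI dest: zero simp del: Union_iff)
  then show ?thesis using union[of bad] sum by linarith
qed

section \<open>Choice of \<open>q\<close> for given \<open>n\<close>, and assembly\<close>

theorem theorem8:
  fixes \<epsilon> :: real
  assumes "0 < \<epsilon>" and "\<epsilon> < 1 / 18"
  shows "\<exists>P :: nat \<Rightarrow> algorithm pmf.
    (\<forall>n. partition_algorithm n (P n)) \<and>
    (\<forall>n. rounds_at_most n (P n) 4) \<and>
    (\<exists>C > 0. \<forall>\<^sub>F n in sequentially. queries_at_most n (P n) (C * real n)) \<and>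
    (\<exists>\<delta> > 0. \<forall>\<^sub>F n in sequentially. \<forall>c \<ge> 0.
       zero_error_prob n c (P n) \<ge> 1 - exp (- \<delta> * real n powr \<epsilon>))"
proof -
  \<comment> \<open>Rounding down ensures \<open>r n ^ 18 \<le> n\<close>, while for large
    \<open>n\<close> the root is still below \<open>2 * r n\<close>.\<close>
  define r where "r n = nat \<lfloor>real n powr (1 / 18)\<rfloor>" for n
  define D where "D n \<omega> = play n (2 ^ 23 * n) (strategies n (r n) \<omega>) {}" for n \<omega>
  define P where "P n = map_pmf (D n) (sample_pmf n (r n))" for n
  have legal: "partition_algorithm n (P n)" for n
    by (auto simp: partition_algorithm_def P_def D_def legal_run_play)
  have rounds: "rounds_at_most n (P n) 4" for n
    by (auto simp: rounds_at_most_def P_def D_def num_rounds_play length_strategies)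
  have budget: "queries_at_most n (P n) (2 ^ 25 * real n)" for n
    unfolding queries_at_most_def
  proof (intro ballI)
    fix T \<pi> assume "T \<in> set_pmf (P n)"
    then obtain \<omega> where "T = D n \<omega>" by (auto simp: P_def)
    then have "num_queries \<pi> T \<le> 2 ^ 23 * n * 4"
      using num_queries_play[of \<pi> n "2 ^ 23 * n" "strategies n (r n) \<omega>" "{}"]
      by (simp only: D_def length_strategies)
    then have "real (num_queries \<pi> T) \<le> real (2 ^ 23 * n * 4)" by (rule of_nat_mono)
    then show "real (num_queries \<pi> T) \<le> 2 ^ 25 * real n" by simp
  qed
  have "zero_error_prob n c (P n) \<ge> 1 - exp (- (1 / 16) * real n powr \<epsilon>)"
    \<comment> \<open>This gives \<open>r n \<ge> 64\<close>, just enough for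
      \<open>9 \<le> 1 + r n / 8\<close>, by which half of the exponent absorbs the factor
      \<open>9\<close>.\<close>
    if n: "64 ^ 18 \<le> n" for n c
  proof -
    let ?x = "real n powr (1 / 18)"
    have x18: "?x ^ 18 = real n" using n by (simp add: powr_power)
    have "real (64 ^ 18) \<le> real n" using n by (rule of_nat_mono)
    then have x64: "64 \<le> ?x"
      using power_le_imp_le_base[of 64 17 ?x] x18 by simp
    have r: "real (r n) \<le> ?x" "?x < real (r n) + 1" using x64 by (auto simp: r_def)
    have q64: "64 \<le> r n" using x64 unfolding r_def by linarith
    have "real (r n) ^ 18 \<le> ?x ^ 18" using r by (intro power_mono) auto
    then have "real (r n ^ 18) \<le> real n" unfolding x18 by simp
    then have lo: "r n ^ 18 \<le> n" by (simp only: of_nat_le_iff)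
    have "?x ^ 18 < (2 * real (r n)) ^ 18" using r q64 x64 by (intro power_strict_mono) auto
    then have "real n < real ((2 * r n) ^ 18)" unfolding x18 by simp
    then have hi: "n < (2 * r n) ^ 18" by (simp only: of_nat_less_iff)
    have "zero_error_prob n c (P n) \<ge> 1 - 9 * exp (- (real (r n) / 4))"
      unfolding P_def D_def using q64 lo hi by (intro zero_error_prob_ge prob_error_le) auto
    moreover have "9 * exp (- (real (r n) / 4)) \<le> exp (- (1 / 16) * real n powr \<epsilon>)"
    proof -
      have "9 \<le> 1 + real (r n) / 8" using q64 by simp
      also have "\<dots> \<le> exp (real (r n) / 8)" by (rule exp_ge_add_one_self)
      finally have "9 * exp (- (real (r n) / 4)) \<le> exp (real (r n) / 8) * exp (- (real (r n) / 4))"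
        by (rule mult_right_mono) simp
      also have "\<dots> = exp (- (real (r n) / 8))" by (simp flip: exp_add)
      also have "\<dots> \<le> exp (- (1 / 16) * real n powr \<epsilon>)"
      proof -
        \<comment> \<open>Here \<open>\<epsilon> < 1 / 18\<close> enters;
          \<open>?x < r n + 1 \<le> 2 * r n\<close> then turns \<open>r n / 8\<close> into the
          constant \<open>1 / 16\<close>.\<close>
        have "real n powr \<epsilon> \<le> ?x" using assms n by (intro powr_mono) auto
        then have "real n powr \<epsilon> \<le> 2 * real (r n)" using r(2) q64 by linarith
        then show ?thesis by simp
      qed
      finally show ?thesis .
    qed
    ultimately show ?thesis by linarith
  qed
  \<comment> \<open>The threshold does not depend on \<open>c\<close>, so the quantifier over
    \<open>c\<close> may stand inside.\<close>
  then have ev: "\<forall>\<^sub>F n in sequentially. \<forall>c \<ge> 0.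
      zero_error_prob n c (P n) \<ge> 1 - exp (- (1 / 16) * real n powr \<epsilon>)"
    by (intro eventually_sequentiallyI[of "64 ^ 18"]) blast
  have "\<exists>\<delta> > 0. \<forall>\<^sub>F n in sequentially. \<forall>c \<ge> 0.
      zero_error_prob n c (P n) \<ge> 1 - exp (- \<delta> * real n powr \<epsilon>)"
    by (rule exI[of _ "1 / 16"], intro conjI ev) simp
  moreover have "\<exists>C > 0. \<forall>\<^sub>F n in sequentially. queries_at_most n (P n) (C * real n)"
    using budget by (intro exI[of _ "2 ^ 25"]) simp
  ultimately show ?thesis using legal rounds by blast
qed

end
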